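(* Let $\Omega\subset\mathbb R^2$ be a domain and $p>2$. For any $\infty$-harmonic function $u$ in $\Omega$ we have $$\big\||Du|\big\|_{L^p(V)}\le C(p)\,\frac{1}{\operatorname{dist}(V,\partial U)}\,\|u-a\|_{L^p(U)}\qquad\text{for all }V\Subset U\Subset\Omega\text{ and all }a\in\mathbb R,$$ where the constant $C(p)$ depends only on $p$.
   Context: A domain is an open connected set. A function $u\in C(\Omega)$ is $\infty$-harmonic in $\Omega$ if $-\Delta_\infty u:=-\sum_{i,j}u_iu_ju_{ij}=0$ in $\Omega$ in the viscosity sense; such functions belong to $W^{1,\infty}_{\mathrm{loc}}(\Omega)$. $V\Subset U$ means that $V$ is a bounded domain with $\overline V\subset U$. *)

theory Defs
  imports "HOL-Analysis.Analysis"
begin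

definition domain :: "'a::topological_space set \<Rightarrow> bool" where
  "domain S \<longleftrightarrow> open S \<and> connected S"

definition compactly_contained :: "'a::metric_space set \<Rightarrow> 'a set \<Rightarrow> bool"
    (infix \<open>\<Subset>\<close> 50) where
  "V \<Subset> U \<longleftrightarrow> bounded V \<and> domain V \<and> closure V \<subseteq> U"

definition partial_deriv :: "'a::euclidean_space \<Rightarrow> ('a \<Rightarrow> real) \<Rightarrow> 'a \<Rightarrow> real" where
  "partial_deriv i f x = frechet_derivative f (at x) i"

text \<open>\<open>C_k k S f\<close>: the function \<open>f\<close> is of class \<open>C^k\<close> on \<open>S\<close>; intended for open \<open>S\<close> only.\<close>

primrec C_k :: "nat \<Rightarrow> 'a::euclidean_space set \<Rightarrow> ('a \<Rightarrow> real) \<Rightarrow> bool" where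
  "C_k 0 S f \<longleftrightarrow> continuous_on S f"
| "C_k (Suc k) S f \<longleftrightarrow>
     (\<forall>x\<in>S. f differentiable (at x)) \<and> (\<forall>i\<in>Basis. C_k k S (partial_deriv i f))"

definition infinity_Laplacian :: "('a::euclidean_space \<Rightarrow> real) \<Rightarrow> 'a \<Rightarrow> real" where
  "infinity_Laplacian f x =
     (\<Sum>i\<in>Basis. \<Sum>j\<in>Basis.
        partial_deriv i f x * partial_deriv j f x * partial_deriv j (partial_deriv i f) x)"

text \<open>Viscosity solutions of \<open>- infinity_Laplacian u = 0\<close>: the equation is tested by functions
  of class \<open>C^2\<close> touching \<open>u\<close>, up to an additive constant, from above (subsolution) or from
  below (supersolution).\<close>

definition infinity_harmonic :: "'a::euclidean_space set \<Rightarrow> ('a \<Rightarrow> real) \<Rightarrow> bool" where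
  "infinity_harmonic \<Omega> u \<longleftrightarrow>
     continuous_on \<Omega> u \<and>
     (\<forall>x0\<in>\<Omega>. \<forall>\<phi>. C_k 2 \<Omega> \<phi> \<longrightarrow>
        ((\<forall>\<^sub>F y in nhds x0. u y - \<phi> y \<le> u x0 - \<phi> x0) \<longrightarrow> - infinity_Laplacian \<phi> x0 \<le> 0) \<and>
        ((\<forall>\<^sub>F y in nhds x0. u y - \<phi> y \<ge> u x0 - \<phi> x0) \<longrightarrow> - infinity_Laplacian \<phi> x0 \<ge> 0))"

definition locally_integrable ::
    "'a::euclidean_space set \<Rightarrow> ('a \<Rightarrow> 'b::euclidean_space) \<Rightarrow> bool" where
  "locally_integrable \<Omega> f \<longleftrightarrow> (\<forall>K. compact K \<and> K \<subseteq> \<Omega> \<longrightarrow> f absolutely_integrable_on K)"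

text \<open>The space of smooth functions with compact support in \<open>\<Omega>\<close>, extended by zero.\<close>

definition test_functions :: "'a::euclidean_space set \<Rightarrow> ('a \<Rightarrow> real) set" where
  "test_functions \<Omega> =
     {\<phi>. (\<forall>k. C_k k UNIV \<phi>) \<and> compact (closure {x. \<phi> x \<noteq> 0}) \<and> closure {x. \<phi> x \<noteq> 0} \<subseteq> \<Omega>}"

definition has_weak_gradient ::
    "'a::euclidean_space set \<Rightarrow> ('a \<Rightarrow> real) \<Rightarrow> ('a \<Rightarrow> 'a) \<Rightarrow> bool" where
  "has_weak_gradient \<Omega> u G \<longleftrightarrow>
     locally_integrable \<Omega> u \<and> locally_integrable \<Omega> G \<and>
     (\<forall>\<phi>\<in>test_functions \<Omega>. \<forall>i\<in>Basis.
        (LINT x:\<Omega>|lebesgue. u x * partial_deriv i \<phi> x) = - (LINT x:\<Omega>|lebesgue. (G x \<bullet> i) * \<phi> x))"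

text \<open>The weak gradient is unique only up to null sets, so \<open>weak_gradient\<close> picks a
  representative. It is meaningful only for weakly differentiable functions; infinity-harmonic
  functions are weakly differentiable because they are locally Lipschitz.\<close>

definition weak_gradient ::
    "'a::euclidean_space set \<Rightarrow> ('a \<Rightarrow> real) \<Rightarrow> 'a \<Rightarrow> 'a" where
  "weak_gradient \<Omega> u = (SOME G. has_weak_gradient \<Omega> u G)"

text \<open>The \<open>L^p\<close> norm takes values in \<open>[0, \<infinity>]\<close>, so that for a measurable function an upper bound
  by a finite quantity includes membership in \<open>L^p\<close>.\<close>

definition Lp_norm :: "real \<Rightarrow> 'a::euclidean_space set \<Rightarrow> ('a \<Rightarrow> real) \<Rightarrow> ennreal" where
  "Lp_norm p A f =
     (let I = \<integral>\<^sup>+x\<in>A. ennreal (\<bar>f x\<bar> powr p) \<partial>lebesgue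
      in if I = \<infinity> then \<infinity> else ennreal (enn2real I powr (1 / p)))"

end

theory Submission
  imports Defs
begin

text \<open>
  Let \<open>u\<close> be infinity-harmonic near the closed ball \<open>B\<^sub>R(x)\<close>. Two facts about \<open>u\<close> give the
  estimate.

  First, comparison with cones: if \<open>\<bar>u - a\<bar> \<le> B\<close> on \<open>B\<^sub>R(x)\<close>, then
  \<open>\<bar>u(y) - u(x)\<bar> \<le> (8 B / R) \<bar>y - x\<bar>\<close> for \<open>y\<close> in the ball of half the radius
  (\<open>infinity_harmonic_Lipschitz_bound\<close>). The cone with vertex \<open>x\<close> is not an admissible test
  function, so it is approximated by smooth functions that are strict supersolutions away from \<open>x\<close>.

  Second, a local maximum principle: the supremum of \<open>\<bar>u - a\<bar>\<^sup>p\<close> over the half ball is at most a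
  constant times its mean over \<open>B\<^sub>R(x)\<close> (\<open>local_maximum_principle\<close>). It follows from the first
  fact: near a point where \<open>\<bar>u - a\<bar>\<close>, suitably weighted, is maximal, the Lipschitz bound keeps
  \<open>\<bar>u - a\<bar>\<close> above half its maximum on a ball of comparable radius, and the integral sees that
  ball.

  Together they bound \<open>\<bar>Du(x)\<bar>\<^sup>p\<close> by \<open>C R\<^sup>-\<^sup>p\<close> times the mean of \<open>\<bar>u - a\<bar>\<^sup>p\<close> over
  \<open>B\<^sub>R(x)\<close>. With \<open>R\<close> equal to half the distance from \<open>V\<close> to the boundary of \<open>U\<close>, all these balls
  lie in \<open>U\<close>, and integrating over \<open>x \<in> V\<close> and exchanging the integrals proves the theorem
  (\<open>integral_gradient_bound\<close>).

  It remains to give \<open>Du\<close> a meaning: the weak gradient is an arbitrary representative, so a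
  locally Lipschitz function must be shown to have a weak gradient that obeys the pointwise
  Lipschitz bounds (\<open>weak_gradient_exists\<close>), and any two weak gradients must agree almost
  everywhere (\<open>weak_gradient_unique\<close>). Differentiability almost everywhere is avoided: the
  gradient is obtained as a weak limit of difference quotients, and it inherits their bounds
  because it is an almost everywhere limit of convex combinations of them
  (\<open>weak_limit_of_bounded_sequence\<close>). Uniqueness is the fundamental lemma of the calculus of
  variations, tested with smooth approximations of indicators of boxes.
\<close>

section \<open>Weak limits of pointwise bounded sequences\<close>

text \<open>These sets stand in for the convex hulls of the tails of the sequence. Closure under
  midpoints is all that the parallelogram identity uses, and rule induction replaces finite
  convex combinations.\<close>

inductive_set tail_midpoints :: "(nat \<Rightarrow> 'a \<Rightarrow> real) \<Rightarrow> nat \<Rightarrow> ('a \<Rightarrow> real) set"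
  for f :: "nat \<Rightarrow> 'a \<Rightarrow> real" and n :: nat where
  tail_member: "n \<le> m \<Longrightarrow> f m \<in> tail_midpoints f n"
| midpoint: "g \<in> tail_midpoints f n \<Longrightarrow> h \<in> tail_midpoints f n \<Longrightarrow>
    (\<lambda>x. (g x + h x) / 2) \<in> tail_midpoints f n"

lemma tail_midpoints_antimono:
  assumes "n \<le> m"
  shows "tail_midpoints f m \<subseteq> tail_midpoints f n"
proof
  fix g assume "g \<in> tail_midpoints f m"
  then show "g \<in> tail_midpoints f n"
    by induction (use assms in \<open>auto intro: tail_midpoints.intros\<close>)
qed

lemma tail_midpoints_measurable:
  assumes "g \<in> tail_midpoints f n" and "\<And>n. f n \<in> borel_measurable M"
  shows "g \<in> borel_measurable M"
  using assms(1) by induction (use assms(2) in auto)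

lemma tail_midpoints_abs_le:
  assumes "g \<in> tail_midpoints f n" and "\<And>m. n \<le> m \<Longrightarrow> \<bar>f m x\<bar> \<le> c"
  shows "\<bar>g x\<bar> \<le> c"
  using assms(1) by induction (use assms(2) in \<open>force simp: abs_le_iff\<close>)+

lemma tail_midpoints_integral_close:
  fixes f :: "nat \<Rightarrow> 'a \<Rightarrow> real"
  assumes g: "g \<in> tail_midpoints f n"
    and int: "\<And>m. n \<le> m \<Longrightarrow> integrable M (\<lambda>x. f m x * \<psi> x)"
    and close: "\<And>m. n \<le> m \<Longrightarrow> \<bar>(\<integral>x. f m x * \<psi> x \<partial>M) - l\<bar> \<le> e"
  shows "integrable M (\<lambda>x. g x * \<psi> x) \<and> \<bar>(\<integral>x. g x * \<psi> x \<partial>M) - l\<bar> \<le> e"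
  using g
proof induction
  case (tail_member m)
  then show ?case using int close by auto
next
  case (midpoint g h)
  have eq: "(\<lambda>x. (g x + h x) / 2 * \<psi> x) = (\<lambda>x. g x * \<psi> x / 2 + h x * \<psi> x / 2)"
    by (auto simp: field_simps)
  have "integrable M (\<lambda>x. (g x + h x) / 2 * \<psi> x)"
    unfolding eq using midpoint by auto
  moreover have "(\<integral>x. (g x + h x) / 2 * \<psi> x \<partial>M)
      = (\<integral>x. g x * \<psi> x \<partial>M) / 2 + (\<integral>x. h x * \<psi> x \<partial>M) / 2"
    unfolding eq using midpoint by simp
  moreover have "\<bar>(\<integral>x. g x * \<psi> x \<partial>M) / 2 + (\<integral>x. h x * \<psi> x \<partial>M) / 2 - l\<bar> \<le> e"
    using midpoint.IH by argo
  ultimately show ?case by argo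
qed

text \<open>A sequential weak compactness theorem in the spirit of Mazur's lemma. Minimising a weighted
  \<open>L\<^sup>2\<close> norm over the midpoint hulls of the tails yields, by the parallelogram identity, a
  Cauchy sequence of midpoints, hence an almost everywhere convergent one. Its limit keeps every
  bound that holds for a tail of \<open>f\<close> at a given point, and it represents every limit of the
  integrals \<open>\<integral> f n * \<psi>\<close> because all tail midpoints give almost the same integral. In the third
  conclusion, the uniform bound is required only where \<open>\<psi>\<close> does not vanish, which lets local
  bounds suffice for compactly supported \<open>\<psi>\<close>.\<close>

lemma weak_limit_of_bounded_sequence:
  fixes f :: "nat \<Rightarrow> 'a \<Rightarrow> real"
  assumes "sigma_finite_measure M"
    and f_meas[measurable]: "\<And>n. f n \<in> borel_measurable M"
    and bdd: "\<And>x. x \<in> space M \<Longrightarrow> bdd_above (range (\<lambda>n. \<bar>f n x\<bar>))"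
  obtains g where "g \<in> borel_measurable M"
    and "\<And>x c N. (\<And>n. n \<ge> N \<Longrightarrow> \<bar>f n x\<bar> \<le> c) \<Longrightarrow> \<bar>g x\<bar> \<le> c"
    and "\<And>\<psi> l B N. integrable M \<psi> \<Longrightarrow>
       (\<And>n x. n \<ge> N \<Longrightarrow> \<psi> x \<noteq> 0 \<Longrightarrow> \<bar>f n x\<bar> \<le> B) \<Longrightarrow>
       (\<lambda>n. \<integral>x. f n x * \<psi> x \<partial>M) \<longlonglongrightarrow> l \<Longrightarrow> (\<integral>x. g x * \<psi> x \<partial>M) = l"
proof -
  interpret sigma_finite_measure M by fact
  define L where "L x = (SUP n. \<bar>f n x\<bar>)" for x
  have L_meas[measurable]: "L \<in> borel_measurable M"
    unfolding L_def by (rule borel_measurable_cSUP) (use bdd in auto)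
  have f_le_L: "\<bar>f n x\<bar> \<le> L x" if "x \<in> space M" for n x
    unfolding L_def by (rule cSUP_upper) (use bdd that in auto)
  obtain h :: "'a \<Rightarrow> real" where h_meas[measurable]: "h \<in> borel_measurable M"
    and h_pos: "\<And>x. 0 < h x" and h_int: "integrable M h"
    by (rule obtain_positive_integrable_function) blast
  \<comment> \<open>With this weight, \<open>w\<close> and \<open>w L\<^sup>2\<close> are both dominated by the integrable function \<open>h\<close>, so every
    function bounded by \<open>L\<close> lies in the weighted \<open>L\<^sup>2\<close> space.\<close>
  define w where "w x = h x / (1 + (L x)\<^sup>2)" for x
  have w_meas[measurable]: "w \<in> borel_measurable M" unfolding w_def by measurable
  have w_pos: "0 < w x" for x unfolding w_def using h_pos[of x]
    by (simp add: add_pos_nonneg)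
  have w_le_h: "w x \<le> h x" for x
    unfolding w_def using h_pos[of x] by (simp add: divide_le_eq add_pos_nonneg mult_le_cancel_left1)
  have w_L_le_h: "w x * (L x)\<^sup>2 \<le> h x" for x
    unfolding w_def using h_pos[of x] by (simp add: divide_le_eq add_pos_nonneg distrib_left)
  have w_int: "integrable M w"
    by (rule Bochner_Integration.integrable_bound[OF h_int]) (use w_le_h w_pos h_pos in \<open>auto intro!: AE_I2 simp: less_imp_le abs_of_pos\<close>)
  have w_sq_bound: "integrable M (\<lambda>x. w x * (k x)\<^sup>2)"
    if [measurable]: "k \<in> borel_measurable M" and "\<And>x. x \<in> space M \<Longrightarrow> \<bar>k x\<bar> \<le> L x" for k
  proof (rule Bochner_Integration.integrable_bound[OF h_int])
    show "AE x in M. norm (w x * (k x)\<^sup>2) \<le> norm (h x)"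
    proof (rule AE_I2)
      fix x assume x: "x \<in> space M"
      have "(k x)\<^sup>2 \<le> (L x)\<^sup>2" using that(2)[OF x] by (simp add: abs_le_square_iff[symmetric])
      then have "w x * (k x)\<^sup>2 \<le> w x * (L x)\<^sup>2"
        using w_pos[of x] by (intro mult_left_mono) auto
      also note w_L_le_h[of x]
      finally show "norm (w x * (k x)\<^sup>2) \<le> norm (h x)"
        using w_pos[of x] h_pos[of x] by (simp add: abs_mult)
    qed
  qed measurable
  let ?T = "tail_midpoints f"
  have T_meas: "k \<in> borel_measurable M" if "k \<in> ?T n" for k n
    using tail_midpoints_measurable[OF that] f_meas by blast
  have T_L: "\<bar>k x\<bar> \<le> L x" if "k \<in> ?T n" "x \<in> space M" for k n x
    using tail_midpoints_abs_le[OF that(1)] f_le_L[OF that(2)] by blast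
  define Q where "Q k = (\<integral>x. w x * (k x)\<^sup>2 \<partial>M)" for k
  define d where "d n = (INF k\<in>?T n. Q k)" for n
  have Q_nonneg: "0 \<le> Q k" for k
    unfolding Q_def by (rule integral_nonneg_AE) (use w_pos in \<open>auto simp: less_imp_le\<close>)
  have Q_bdd: "bdd_below (Q ` A)" for A
    by (rule bdd_belowI[of _ 0]) (use Q_nonneg in auto)
  have T_ne: "?T n \<noteq> {}" for n using tail_member[of n n f] by auto
  have d_le: "d n \<le> Q k" if "k \<in> ?T n" for k n
    unfolding d_def by (rule cINF_lower[OF Q_bdd that])
  have d_mono: "d n \<le> d m" if "n \<le> m" for n m
    unfolding d_def by (rule cINF_superset_mono[OF T_ne Q_bdd tail_midpoints_antimono[OF that]]) auto
  have d_upper: "d n \<le> (\<integral>x. h x \<partial>M)" for n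
  proof -
    have "d n \<le> Q (f n)" by (rule d_le) (auto intro: tail_member)
    also have "\<dots> \<le> (\<integral>x. h x \<partial>M)" unfolding Q_def
    proof (rule integral_mono)
      show "integrable M (\<lambda>x. w x * (f n x)\<^sup>2)" by (rule w_sq_bound) (use f_le_L in auto)
      fix x assume x: "x \<in> space M"
      have "(f n x)\<^sup>2 \<le> (L x)\<^sup>2" using order_trans[OF f_le_L[OF x] abs_ge_self] by (simp add: abs_le_square_iff[symmetric])
      then have "w x * (f n x)\<^sup>2 \<le> w x * (L x)\<^sup>2"
        using w_pos[of x] by (intro mult_left_mono) auto
      with w_L_le_h[of x] show "w x * (f n x)\<^sup>2 \<le> h x" by linarith
    qed fact
    finally show ?thesis .
  qed
  have "\<exists>k\<in>?T n. Q k < d n + 1 / real (Suc n)" for n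
  proof -
    have "(INF k\<in>?T n. Q k) < d n + 1 / real (Suc n)" unfolding d_def by simp
    then show ?thesis by (simp add: cINF_less_iff[OF T_ne Q_bdd])
  qed
  then obtain k where kT: "\<And>n. k n \<in> ?T n" and kQ: "\<And>n. Q (k n) < d n + 1 / real (Suc n)"
    by metis
  have k_meas[measurable]: "k n \<in> borel_measurable M" for n using T_meas kT by blast
  have k_L: "\<bar>k n x\<bar> \<le> L x" if "x \<in> space M" for n x using T_L kT that by blast
  have k_sq_int: "integrable M (\<lambda>x. w x * (k n x)\<^sup>2)" for n
    by (rule w_sq_bound) (use k_L in auto)
  have diff_sq_int: "integrable M (\<lambda>x. w x * (k i x - k j x)\<^sup>2)" for i j
  proof -
    have "integrable M (\<lambda>x. 4 * (w x * ((k i x - k j x) / 2)\<^sup>2))"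
    proof (intro integrable_mult_right w_sq_bound)
      fix x assume "x \<in> space M"
      then show "\<bar>(k i x - k j x) / 2\<bar> \<le> L x"
        using k_L[of x i] k_L[of x j] by argo
    qed measurable
    then show ?thesis by (simp add: power_divide)
  qed
  \<comment> \<open>The midpoint of two near-minimisers cannot beat the infimum, so they are close.\<close>
  have parallelogram: "(\<integral>x. w x * (k i x - k j x)\<^sup>2 \<partial>M) \<le> 2 * (d j - d i) + 4 / real (Suc i)"
    if "i \<le> j" for i j
  proof -
    have mid: "(\<lambda>x. (k i x + k j x) / 2) \<in> ?T i"
      using kT[of i] kT[of j] tail_midpoints_antimono[OF that] by (auto intro: midpoint)
    have mid_int: "integrable M (\<lambda>x. w x * ((k i x + k j x) / 2)\<^sup>2)"
      by (rule w_sq_bound) (use T_meas[OF mid] T_L[OF mid] in auto)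
    have "(\<integral>x. w x * (k i x - k j x)\<^sup>2 \<partial>M)
        = (\<integral>x. 2 * (w x * (k i x)\<^sup>2) + 2 * (w x * (k j x)\<^sup>2) - 4 * (w x * ((k i x + k j x) / 2)\<^sup>2) \<partial>M)"
      by (rule Bochner_Integration.integral_cong) (auto simp: power2_eq_square field_simps)
    also have "\<dots> = 2 * Q (k i) + 2 * Q (k j) - 4 * Q (\<lambda>x. (k i x + k j x) / 2)"
      unfolding Q_def using k_sq_int mid_int by simp
    also have "\<dots> \<le> 2 * (d j - d i) + 4 / real (Suc i)"
    proof -
      have "1 / real (Suc j) \<le> 1 / real (Suc i)" using that by (simp add: frac_le)
      with kQ[of i] kQ[of j] d_le[OF mid] show ?thesis by argo
    qed
    finally show ?thesis .
  qed
  have d_conv: "convergent d"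
  proof (rule Bseq_mono_convergent)
    have "0 \<le> d n" for n
      unfolding d_def by (rule cINF_greatest[OF T_ne]) (rule Q_nonneg)
    then show "Bseq d"
      using d_upper by (intro BseqI'[where K = "\<integral>x. h x \<partial>M"]) simp
  qed (use d_mono in auto)
  have W: "0 \<le> (\<integral>x. w x \<partial>M)" by (rule integral_nonneg_AE) (use w_pos in \<open>auto simp: less_imp_le\<close>)
  have wk_int: "integrable M (\<lambda>x. w x * k n x)" for n
  proof (rule Bochner_Integration.integrable_bound[OF h_int])
    show "AE x in M. norm (w x * k n x) \<le> norm (h x)"
    proof (rule AE_I2)
      fix x assume x: "x \<in> space M"
      have "\<bar>k n x\<bar> \<le> 1 + (L x)\<^sup>2"
        using k_L[OF x, of n] zero_le_power2[of "L x - 1"] zero_le_power2[of "L x"]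
        by (simp add: power2_diff)
      then have "w x * \<bar>k n x\<bar> \<le> w x * (1 + (L x)\<^sup>2)"
        using w_pos[of x] by (intro mult_left_mono) auto
      also have "\<dots> = h x" unfolding w_def by (simp add: add_nonneg_eq_0_iff)
      finally show "norm (w x * k n x) \<le> norm (h x)"
        using w_pos[of x] h_pos[of x] by (simp add: abs_mult)
    qed
  qed measurable
  have L1_Cauchy: "\<exists>N. \<forall>i\<ge>N. \<forall>j\<ge>N. (\<integral>x. norm (w x * k i x - w x * k j x) \<partial>M) < e" if e: "e > 0" for e :: real
  proof -
    define W where "W = (\<integral>x. w x \<partial>M) + 1"
    have W1: "W > 0" using W by (simp add: W_def)
    \<comment> \<open>Parameter of Young's inequality \<open>\<bar>r\<bar> \<le> t / 2 + r\<^sup>2 / (2 t)\<close>, which turns the weighted \<open>L\<^sup>2\<close>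
      Cauchy property into an \<open>L\<^sup>1\<close> one.\<close>
    define t where "t = e / W"
    have t: "t > 0" using e W1 by (simp add: t_def)
    have et: "0 < e * t / 4" using e t by simp
    obtain N1 where N1: "\<And>i j. i \<ge> N1 \<Longrightarrow> j \<ge> N1 \<Longrightarrow> \<bar>d i - d j\<bar> < e * t / 4"
      using convergent_Cauchy[OF d_conv] et unfolding Cauchy_def dist_real_def by metis
    obtain N2 where N2: "1 / real (Suc N2) < e * t / 8"
      using nat_approx_posE[of "e * t / 8"] et by auto
    define N where "N = max N1 N2"
    have main: "(\<integral>x. norm (w x * k i x - w x * k j x) \<partial>M) < e" if "N \<le> i" "i \<le> j" for i j
    proof -
      have "(\<integral>x. norm (w x * k i x - w x * k j x) \<partial>M) \<le> (\<integral>x. (t / 2) * w x + (1 / (2 * t)) * (w x * (k i x - k j x)\<^sup>2) \<partial>M)"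
      proof (rule integral_mono)
        show "integrable M (\<lambda>x. norm (w x * k i x - w x * k j x))"
          using wk_int by (intro integrable_norm Bochner_Integration.integrable_diff)
        show "integrable M (\<lambda>x. (t / 2) * w x + (1 / (2 * t)) * (w x * (k i x - k j x)\<^sup>2))"
          using w_int diff_sq_int[of i j] by auto
        fix x
        have *: "\<bar>r\<bar> \<le> t / 2 + 1 / (2 * t) * r\<^sup>2" for r :: real
        proof -
          have "0 \<le> (t - \<bar>r\<bar>)\<^sup>2" by simp
          then have "2 * t * \<bar>r\<bar> \<le> t\<^sup>2 + r\<^sup>2" by (simp add: power2_diff)
          then show ?thesis using t by (simp add: field_simps power2_eq_square)
        qed
        have "w x * \<bar>k i x - k j x\<bar> \<le> w x * (t / 2 + 1 / (2 * t) * (k i x - k j x)\<^sup>2)"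
          using w_pos[of x] by (intro mult_left_mono *) auto
        also have "\<dots> = (t / 2) * w x + (1 / (2 * t)) * (w x * (k i x - k j x)\<^sup>2)"
          by (simp add: distrib_left)
        finally show "norm (w x * k i x - w x * k j x) \<le> (t / 2) * w x + (1 / (2 * t)) * (w x * (k i x - k j x)\<^sup>2)"
          using w_pos[of x] by (simp add: abs_mult flip: right_diff_distrib)
      qed
      also have "\<dots> = (t / 2) * (\<integral>x. w x \<partial>M) + (1 / (2 * t)) * (\<integral>x. w x * (k i x - k j x)\<^sup>2 \<partial>M)"
        using w_int diff_sq_int[of i j] by simp
      also have "\<dots> < e"
      proof -
        have "1 / real (Suc i) \<le> 1 / real (Suc N2)" using that by (simp add: frac_le N_def)
        then have "(\<integral>x. w x * (k i x - k j x)\<^sup>2 \<partial>M) < 2 * (e * t / 4) + 4 * (e * t / 8)"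
        proof -
          have "d j - d i < e * t / 4"
            by (rule le_less_trans[OF abs_ge_self N1]) (use that in \<open>auto simp: N_def\<close>)
          moreover have "4 / real (Suc i) < 4 * (e * t / 8)"
            using N2 \<open>1 / real (Suc i) \<le> 1 / real (Suc N2)\<close> by simp
          ultimately have "2 * (d j - d i) + 4 / real (Suc i) < 2 * (e * t / 4) + 4 * (e * t / 8)"
            by (intro add_strict_mono mult_strict_left_mono) auto
          with parallelogram[OF that(2)] show ?thesis by (rule le_less_trans)
        qed
        then have "(1 / (2 * t)) * (\<integral>x. w x * (k i x - k j x)\<^sup>2 \<partial>M) < e / 2"
          using t by (simp add: pos_divide_less_eq mult.commute)
        moreover have "(t / 2) * (\<integral>x. w x \<partial>M) \<le> (t / 2) * W"
          using t by (intro mult_left_mono) (auto simp: W_def)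
        moreover have "(t / 2) * W = e / 2" using W1 by (simp add: t_def)
        ultimately show ?thesis by linarith
      qed
      finally show ?thesis .
    qed
    show ?thesis
    proof (intro exI allI impI)
      fix i j assume "N \<le> i" "N \<le> j"
      then show "(\<integral>x. norm (w x * k i x - w x * k j x) \<partial>M) < e"
        using main[of i j] main[of j i] by (cases "i \<le> j") (auto simp: abs_minus_commute)
    qed
  qed
  obtain r where r: "strict_mono r" and rC: "AE x in M. Cauchy (\<lambda>i. w x * k (r i) x)"
    using cauchy_L1_AE_cauchy_subseq[where s = "\<lambda>n x. w x * k n x" and M = M, OF wk_int L1_Cauchy] by blast
  define g where "g x = (if Cauchy (\<lambda>i. k (r i) x) then lim (\<lambda>i. k (r i) x) else 0)" for x
  have g_meas[measurable]: "g \<in> borel_measurable M" unfolding g_def by measurable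
  have r_ge: "i \<le> r i" for i using r by (rule seq_suble)
  show thesis
  proof
    show "g \<in> borel_measurable M" by measurable
  next
    fix x c N assume c: "\<And>n. n \<ge> N \<Longrightarrow> \<bar>f n x\<bar> \<le> c"
    have "0 \<le> c" using c[of N] by auto
    show "\<bar>g x\<bar> \<le> c"
    proof (cases "Cauchy (\<lambda>i. k (r i) x)")
      case True
      then have "(\<lambda>i. k (r i) x) \<longlonglongrightarrow> g x"
        by (simp add: g_def Cauchy_convergent convergent_LIMSEQ_iff[symmetric])
      then have "(\<lambda>i. \<bar>k (r i) x\<bar>) \<longlonglongrightarrow> \<bar>g x\<bar>" by (rule tendsto_rabs)
      moreover have "\<bar>k (r i) x\<bar> \<le> c" if "i \<ge> N" for i
        by (rule tail_midpoints_abs_le[OF kT[of "r i"]]) (use c that r_ge[of i] in auto)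
      ultimately show ?thesis by (intro LIMSEQ_le_const2) auto
    next
      case False
      then show ?thesis using \<open>0 \<le> c\<close> by (simp add: g_def)
    qed
  next
    fix \<psi> :: "'a \<Rightarrow> real" and l B N
    assume \<psi>: "integrable M \<psi>" and B: "\<And>n x. n \<ge> N \<Longrightarrow> \<psi> x \<noteq> 0 \<Longrightarrow> \<bar>f n x\<bar> \<le> B"
      and lim: "(\<lambda>n. \<integral>x. f n x * \<psi> x \<partial>M) \<longlonglongrightarrow> l"
    have [measurable]: "\<psi> \<in> borel_measurable M" using \<psi> by auto
    have f_int: "integrable M (\<lambda>x. f n x * \<psi> x)" if "n \<ge> N" for n
    proof (rule Bochner_Integration.integrable_bound)
      show "integrable M (\<lambda>x. B * \<psi> x)" using \<psi> by simp
      show "AE x in M. norm (f n x * \<psi> x) \<le> norm (B * \<psi> x)"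
      proof (rule AE_I2)
        fix x
        have "\<bar>f n x\<bar> \<le> \<bar>B\<bar>" if "\<psi> x \<noteq> 0"
          using B[OF \<open>n \<ge> N\<close> that] by linarith
        then show "norm (f n x * \<psi> x) \<le> norm (B * \<psi> x)"
          by (cases "\<psi> x = 0") (auto simp: abs_mult intro!: mult_right_mono)
      qed
    qed measurable
    \<comment> \<open>The tail from \<open>N\<close> on is dominated by a multiple of \<open>\<psi>\<close>.\<close>
    define s where "s i x = k (r (i + N)) x * \<psi> x" for i x
    have s_T: "k (r (i + N)) \<in> ?T (i + N)" for i
      using kT[of "r (i + N)"] tail_midpoints_antimono[OF r_ge[of "i + N"]] by blast
    have "(\<lambda>i. \<integral>x. s i x \<partial>M) \<longlonglongrightarrow> (\<integral>x. g x * \<psi> x \<partial>M)"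
    proof (rule integral_dominated_convergence[where w = "\<lambda>x. B * \<bar>\<psi> x\<bar>"])
      show "s i \<in> borel_measurable M" for i unfolding s_def by measurable
      show "integrable M (\<lambda>x. B * \<bar>\<psi> x\<bar>)" using \<psi> by simp
      show "AE x in M. (\<lambda>i. s i x) \<longlonglongrightarrow> g x * \<psi> x"
        using rC
      proof eventually_elim
        case (elim x)
        then have "convergent (\<lambda>i. w x * k (r i) x)" by (simp add: Cauchy_convergent)
        then have "Cauchy (\<lambda>i. k (r i) x)"
          using w_pos[of x] convergent_mult_const_iff[of "w x" "\<lambda>i. k (r i) x"]
          by (simp add: convergent_Cauchy)
        then have "(\<lambda>i. k (r i) x) \<longlonglongrightarrow> g x"
          by (simp add: g_def Cauchy_convergent convergent_LIMSEQ_iff[symmetric])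
        then have "(\<lambda>i. k (r (i + N)) x) \<longlonglongrightarrow> g x" by (rule LIMSEQ_ignore_initial_segment)
        then show ?case unfolding s_def by (intro tendsto_mult_right)
      qed
      show "AE x in M. norm (s i x) \<le> B * \<bar>\<psi> x\<bar>" for i
      proof (rule AE_I2)
        fix x
        have "\<bar>k (r (i + N)) x\<bar> \<le> B" if "\<psi> x \<noteq> 0"
          by (rule tail_midpoints_abs_le[OF s_T]) (use B that in auto)
        then show "norm (s i x) \<le> B * \<bar>\<psi> x\<bar>"
          unfolding s_def by (cases "\<psi> x = 0") (auto simp: abs_mult intro!: mult_right_mono)
      qed
    qed measurable
    moreover have "(\<lambda>i. \<integral>x. s i x \<partial>M) \<longlonglongrightarrow> l"
    proof (rule LIMSEQ_I)
      fix e :: real assume "0 < e"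
      then obtain K where K: "\<And>n. n \<ge> K \<Longrightarrow> \<bar>(\<integral>x. f n x * \<psi> x \<partial>M) - l\<bar> < e / 2"
        using LIMSEQ_D[OF lim, of "e / 2"] by auto
      have "norm ((\<integral>x. s i x \<partial>M) - l) < e" if "i \<ge> K" for i
      proof -
        have "\<bar>(\<integral>x. s i x \<partial>M) - l\<bar> \<le> e / 2"
          unfolding s_def
          by (rule conjunct2[OF tail_midpoints_integral_close[OF s_T]])
             (use f_int K that in \<open>auto intro!: less_imp_le\<close>)
        with \<open>0 < e\<close> show ?thesis by simp
      qed
      then show "\<exists>K. \<forall>i\<ge>K. norm ((\<integral>x. s i x \<partial>M) - l) < e" by blast
    qed
    ultimately show "(\<integral>x. g x * \<psi> x \<partial>M) = l" by (rule LIMSEQ_unique)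
  qed
qed

section \<open>Smooth bump functions on boxes\<close>

lemma partial_deriv_eqI: "(f has_derivative f') (at x) \<Longrightarrow> partial_deriv i f x = f' i"
  unfolding partial_deriv_def using frechet_derivative_at by metis

lemma C_k_SucD: "C_k (Suc k) S f \<Longrightarrow> C_k k S f"
proof (induction k arbitrary: f)
  case 0
  then show ?case
    by (simp add: continuous_at_imp_continuous_on differentiable_imp_continuous_within)
next
  case (Suc k)
  then show ?case by simp
qed

lemma C_k_const: "C_k k S (\<lambda>x. c)"
proof (induction k arbitrary: c)
  case (Suc k)
  have "partial_deriv i (\<lambda>x::'a. c) = (\<lambda>x. 0)" for i
    by (auto intro!: partial_deriv_eqI)
  with Suc show ?case by simp
qed simp

lemma C_k_add: "C_k k UNIV f \<Longrightarrow> C_k k UNIV g \<Longrightarrow> C_k k UNIV (\<lambda>x. f x + g x)"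
proof (induction k arbitrary: f g)
  case (Suc k)
  then have "\<And>x. f differentiable (at x)" "\<And>x. g differentiable (at x)" by auto
  then have "partial_deriv i (\<lambda>x. f x + g x) = (\<lambda>x. partial_deriv i f x + partial_deriv i g x)" for i
    unfolding partial_deriv_def
    by (intro ext partial_deriv_eqI[unfolded partial_deriv_def, THEN trans] has_derivative_add)
       (auto simp: frechet_derivative_works[symmetric])
  with Suc show ?case by (auto intro!: derivative_intros)
qed (auto intro: continuous_on_add)

lemma C_k_mult: "C_k k UNIV f \<Longrightarrow> C_k k UNIV g \<Longrightarrow> C_k k UNIV (\<lambda>x. f x * g x)"
proof (induction k arbitrary: f g)
  case (Suc k)
  then have f: "\<And>x. f differentiable (at x)" and g: "\<And>x. g differentiable (at x)" by auto
  then have "partial_deriv i (\<lambda>x. f x * g x)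
      = (\<lambda>x. f x * partial_deriv i g x + partial_deriv i f x * g x)" for i
    unfolding partial_deriv_def
    by (intro ext partial_deriv_eqI[unfolded partial_deriv_def, THEN trans] has_derivative_mult)
       (auto simp: frechet_derivative_works[symmetric])
  moreover have "C_k k UNIV f" "C_k k UNIV g" using Suc.prems by (auto intro: C_k_SucD simp del: C_k.simps)
  ultimately show ?case using Suc f g by (auto intro!: derivative_intros C_k_add)
qed (auto intro: continuous_on_mult)

lemma C_k_prod:
  assumes "finite I" and "\<And>i. i \<in> I \<Longrightarrow> C_k k UNIV (f i)"
  shows "C_k k UNIV (\<lambda>x. \<Prod>i\<in>I. f i x)"
  using assms by (induction I) (auto intro: C_k_const C_k_mult)

text \<open>The flat function \<open>exp(-1/t)\<close> times powers of \<open>1/t\<close>. The whole family is defined at once because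
  its span is closed under differentiation, so that smoothness of all members is proved by one
  induction.\<close>

definition flat_exp :: "nat \<Rightarrow> real \<Rightarrow> real" where
  "flat_exp j t = (if 0 < t then exp (- inverse t) * inverse t ^ j else 0)"

lemma flat_exp_div_tendsto: "((\<lambda>h. flat_exp j h / h) \<longlongrightarrow> 0) (at 0)"
proof -
  have "((\<lambda>h. flat_exp j h / h) \<longlongrightarrow> 0) (at_left 0)"
    by (rule tendsto_eventually) (auto simp: flat_exp_def eventually_at_filter)
  moreover have "((\<lambda>h. flat_exp j h / h) \<longlongrightarrow> 0) (at_right 0)"
  proof (rule Lim_transform_eventually)
    show "((\<lambda>h::real. inverse h ^ Suc j / exp (inverse h)) \<longlongrightarrow> 0) (at_right 0)"
      by (rule filterlim_compose[OF tendsto_power_div_exp_0 filterlim_inverse_at_top_right])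
    show "\<forall>\<^sub>F h in at_right 0. inverse h ^ Suc j / exp (inverse h) = flat_exp j h / h"
      by (auto simp: flat_exp_def eventually_at_filter exp_minus field_simps)
  qed
  ultimately show ?thesis by (simp add: filterlim_split_at)
qed

lemma DERIV_flat_exp:
  "(flat_exp j has_real_derivative flat_exp (j + 2) t - real j * flat_exp (j + 1) t) (at t)"
proof -
  consider "t < 0" | "t = 0" | "0 < t" by linarith
  then show ?thesis
  proof cases
    case 1
    then have "flat_exp (j + 2) t - real j * flat_exp (j + 1) t = 0" by (simp add: flat_exp_def)
    moreover have "(flat_exp j has_real_derivative 0) (at t)"
      by (rule has_field_derivative_transform_within_open[of "\<lambda>_. 0" _ _ "{..<0}"])
         (use 1 in \<open>auto simp: flat_exp_def\<close>)
    ultimately show ?thesis by simp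
  next
    case 2
    then show ?thesis
      using flat_exp_div_tendsto[of j] by (simp add: DERIV_def flat_exp_def)
  next
    case 3
    have "((\<lambda>t. exp (- inverse t)) has_real_derivative exp (- inverse t) * (inverse t)\<^sup>2) (at t)"
      using 3 by (auto intro!: derivative_eq_intros simp: power2_eq_square)
    moreover have "((\<lambda>t. inverse t ^ j) has_real_derivative - (real j * inverse t ^ (j + 1))) (at t)"
      using DERIV_power[OF DERIV_inverse[of t], of j] 3
      by (cases j) (auto simp: algebra_simps power2_eq_square)
    ultimately have "((\<lambda>t. exp (- inverse t) * inverse t ^ j) has_real_derivative
        exp (- inverse t) * inverse t ^ (j + 2) - real j * (exp (- inverse t) * inverse t ^ (j + 1))) (at t)"
      by (rule DERIV_cong[OF DERIV_mult]) (simp add: algebra_simps power2_eq_square)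
    then have "(flat_exp j has_real_derivative
        exp (- inverse t) * inverse t ^ (j + 2) - real j * (exp (- inverse t) * inverse t ^ (j + 1))) (at t)"
      by (rule has_field_derivative_transform_within_open[of _ _ _ "{0<..}"])
         (use 3 in \<open>auto simp: flat_exp_def\<close>)
    then show ?thesis using 3 by (simp add: flat_exp_def)
  qed
qed

lemma C_k_flat_exp: "C_k k UNIV (\<lambda>x::'a::euclidean_space. flat_exp j (r * (x \<bullet> i) + s))"
proof (induction k arbitrary: j)
  case 0
  have cont: "continuous_on UNIV (flat_exp j)"
    using DERIV_flat_exp DERIV_isCont by (blast intro: continuous_at_imp_continuous_on)
  show ?case
    unfolding C_k.simps by (rule continuous_on_compose2[OF cont]) (auto intro!: continuous_intros)
next
  case (Suc k)
  define D where "D x = flat_exp (j + 2) (r * (x \<bullet> i) + s) + (- real j) * flat_exp (j + 1) (r * (x \<bullet> i) + s)" for x :: 'a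
  have deriv: "((\<lambda>x::'a. flat_exp j (r * (x \<bullet> i) + s)) has_derivative (\<lambda>v. (r * (v \<bullet> i)) * D x)) (at x)" for x
  proof -
    have "((\<lambda>x::'a. r * (x \<bullet> i) + s) has_derivative (\<lambda>v. r * (v \<bullet> i))) (at x)"
      by (auto intro!: derivative_eq_intros)
    from DERIV_compose_FDERIV[OF DERIV_flat_exp this, of j] show ?thesis
      by (simp add: D_def)
  qed
  then have "partial_deriv b (\<lambda>x::'a. flat_exp j (r * (x \<bullet> i) + s)) = (\<lambda>x. (r * (b \<bullet> i)) * D x)" for b
    by (intro ext partial_deriv_eqI) 
  moreover have "C_k k UNIV D"
    unfolding D_def by (intro C_k_add C_k_mult C_k_const Suc)
  ultimately show ?case
    using deriv by (auto simp: differentiable_def intro!: C_k_mult C_k_const)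
qed

text \<open>The arguments are \<open>n (x - a)\<close> and \<open>n (b - x)\<close> in each coordinate, written in the affine form of
  \<open>C_k_flat_exp\<close>. As \<open>n\<close> grows, the functions tend to the indicator of the open box.\<close>

definition box_bump :: "'a::euclidean_space \<Rightarrow> 'a \<Rightarrow> nat \<Rightarrow> 'a \<Rightarrow> real" where
  "box_bump a b n x = (\<Prod>i\<in>Basis. flat_exp 0 (real n * (x \<bullet> i) + - real n * (a \<bullet> i)) *
     flat_exp 0 (- real n * (x \<bullet> i) + real n * (b \<bullet> i)))"

lemma flat_exp_0_bounds: "0 \<le> flat_exp 0 t" "flat_exp 0 t \<le> 1"
  by (auto simp: flat_exp_def)

lemma box_bump_bounds: "0 \<le> box_bump a b n x" "box_bump a b n x \<le> 1"
  unfolding box_bump_def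
  by (auto intro!: prod_nonneg prod_le_1 mult_le_one simp: flat_exp_0_bounds)

lemma box_bump_eq_0:
  assumes "x \<notin> box a b"
  shows "box_bump a b n x = 0"
proof -
  obtain i where i: "i \<in> Basis" "x \<bullet> i \<le> a \<bullet> i \<or> b \<bullet> i \<le> x \<bullet> i"
    using assms by (auto simp: mem_box not_less)
  have "real n * (x \<bullet> i) + - real n * (a \<bullet> i) = real n * (x \<bullet> i - a \<bullet> i)"
    "- real n * (x \<bullet> i) + real n * (b \<bullet> i) = real n * (b \<bullet> i - x \<bullet> i)"
    by (auto simp: algebra_simps)
  then have "flat_exp 0 (real n * (x \<bullet> i) + - real n * (a \<bullet> i)) *
     flat_exp 0 (- real n * (x \<bullet> i) + real n * (b \<bullet> i)) = 0"
    using i(2) by (auto simp: flat_exp_def zero_less_mult_iff)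
  with i(1) show ?thesis unfolding box_bump_def by (intro prod_zero) auto
qed

lemma box_bump_test_function:
  assumes "cbox a b \<subseteq> \<Omega>"
  shows "box_bump a b n \<in> test_functions \<Omega>"
proof -
  have "{x. box_bump a b n x \<noteq> 0} \<subseteq> cbox a b"
    using box_bump_eq_0 box_subset_cbox by blast
  then have sub: "closure {x. box_bump a b n x \<noteq> 0} \<subseteq> cbox a b"
    by (rule closure_minimal) (rule closed_cbox)
  then have "compact (closure {x. box_bump a b n x \<noteq> 0})"
    by (auto simp: compact_eq_bounded_closed intro: bounded_subset[OF bounded_cbox])
  moreover have "C_k k UNIV (box_bump a b n)" for k
    unfolding box_bump_def by (intro C_k_prod C_k_mult C_k_flat_exp finite_Basis)
  ultimately show ?thesis using sub assms by (auto simp: test_functions_def)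
qed

lemma box_bump_tendsto: "(\<lambda>n. box_bump a b n x) \<longlonglongrightarrow> indicator (box a b) x"
proof (cases "x \<in> box a b")
  case True
  have lim: "(\<lambda>n. flat_exp 0 (real n * t)) \<longlonglongrightarrow> 1" if "0 < t" for t
  proof (rule Lim_transform_eventually)
    have "filterlim (\<lambda>n. real n * t) at_top sequentially"
      using that by (intro filterlim_at_top_mult_tendsto_pos[OF tendsto_const _ filterlim_real_sequentially])
    then have "(\<lambda>n. inverse (real n * t)) \<longlonglongrightarrow> 0"
      by (rule filterlim_compose[OF tendsto_inverse_0_at_top[OF filterlim_ident]])
    then have "(\<lambda>n. exp (- inverse (real n * t))) \<longlonglongrightarrow> exp (- 0)" by (intro tendsto_intros)
    then show "(\<lambda>n. exp (- inverse (real n * t))) \<longlonglongrightarrow> 1" by simp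
    show "\<forall>\<^sub>F n in sequentially. exp (- inverse (real n * t)) = flat_exp 0 (real n * t)"
      using eventually_gt_at_top[of 0] by eventually_elim (use that in \<open>simp add: flat_exp_def\<close>)
  qed
  have eqs: "real n * (x \<bullet> i) + - real n * (a \<bullet> i) = real n * (x \<bullet> i - a \<bullet> i)"
    "- real n * (x \<bullet> i) + real n * (b \<bullet> i) = real n * (b \<bullet> i - x \<bullet> i)" for n i
    by (auto simp: algebra_simps)
  have "(\<lambda>n. box_bump a b n x) \<longlonglongrightarrow> (\<Prod>i\<in>(Basis::'a set). 1 * 1)"
    unfolding box_bump_def eqs
    by (intro tendsto_prod tendsto_mult lim) (use True in \<open>auto simp: mem_box\<close>)
  then show ?thesis using True by simp
qed (simp add: box_bump_eq_0)

section \<open>The fundamental lemma of the calculus of variations\<close>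

text \<open>Passing to the limit in \<open>\<integral> h * box_bump a b n = 0\<close> by dominated convergence.\<close>

lemma integral_eq_0_on_box:
  fixes h :: "'a::euclidean_space \<Rightarrow> real"
  assumes int: "locally_integrable \<Omega> h"
    and zero: "\<And>\<phi>. \<phi> \<in> test_functions \<Omega> \<Longrightarrow> (LINT x:\<Omega>|lebesgue. h x * \<phi> x) = 0"
    and box: "cbox a b \<subseteq> \<Omega>"
  shows "(LINT x:box a b|lebesgue. h x) = 0"
proof -
  define H where "H x = indicator (cbox a b) x * h x" for x
  have h_int: "integrable lebesgue H"
    using int box unfolding H_def[abs_def] locally_integrable_def set_integrable_def by auto
  have [measurable]: "H \<in> borel_measurable lebesgue"
    using h_int by auto
  have [measurable]: "box a b \<in> sets lebesgue" by (simp add: sets_completionI_sets)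
  have bump_meas[measurable]: "box_bump a b n \<in> borel_measurable lebesgue" for n
  proof -
    have "C_k 0 UNIV (box_bump a b n)"
      using box_bump_test_function[OF box, of n] unfolding test_functions_def by blast
    then show ?thesis by (intro measurable_completion) (simp add: borel_measurable_continuous_onI)
  qed
  have "(\<lambda>n. \<integral>x. H x * box_bump a b n x \<partial>lebesgue)
     \<longlonglongrightarrow> (\<integral>x. H x * indicator (box a b) x \<partial>lebesgue)"
  proof (rule integral_dominated_convergence[where w = "\<lambda>x. \<bar>H x\<bar>"])
    show "AE x in lebesgue. (\<lambda>n. H x * box_bump a b n x)
        \<longlonglongrightarrow> H x * indicator (box a b) x"
      by (intro AE_I2 tendsto_mult_left box_bump_tendsto)
    show "AE x in lebesgue. norm (H x * box_bump a b n x)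
        \<le> \<bar>H x\<bar>" for n
      using box_bump_bounds[of a b n] by (intro AE_I2) (auto simp: abs_mult intro!: mult_right_le_one_le mult_nonneg_nonneg)
    show "integrable lebesgue (\<lambda>x. \<bar>H x\<bar>)" using h_int by (rule integrable_abs)
  qed measurable
  moreover have "(\<integral>x. H x * box_bump a b n x \<partial>lebesgue) = 0" for n
  proof -
    have "(\<lambda>x. H x * box_bump a b n x) = (\<lambda>x. indicator \<Omega> x * (h x * box_bump a b n x))"
    proof
      fix x
      show "H x * box_bump a b n x = indicator \<Omega> x * (h x * box_bump a b n x)"
        using box box_subset_cbox[of a b] box_bump_eq_0[of x a b n]
        by (cases "x \<in> box a b") (auto simp: H_def indicator_def)
    qed
    then show ?thesis
      using zero[OF box_bump_test_function[OF box, of n]] by (simp add: set_lebesgue_integral_def)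
  qed
  ultimately have "(\<integral>x. H x * indicator (box a b) x \<partial>lebesgue) = 0"
    by (simp add: LIMSEQ_const_iff)
  moreover have "(\<lambda>x. H x * indicator (box a b) x) = (\<lambda>x. indicator (box a b) x * h x)"
    using box_subset_cbox[of a b] by (auto simp: H_def indicator_def fun_eq_iff)
  ultimately show ?thesis by (simp add: set_lebesgue_integral_def)
qed

text \<open>Boxes form an intersection-stable generator of the Borel sets, so the integral of \<open>F\<close> vanishes
  over every Borel set by a Dynkin argument.\<close>

lemma AE_eq_0_if_integral_boxes_eq_0:
  fixes F :: "'a::euclidean_space \<Rightarrow> real"
  assumes F: "integrable lebesgue F"
    and boxes: "\<And>a b. (LINT x:box a b|lebesgue. F x) = 0"
  shows "AE x in lebesgue. F x = 0"
proof -
  \<comment> \<open>A Borel representative, since the Dynkin argument reaches only the Borel sets.\<close>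
  obtain F' where F'[measurable]: "F' \<in> borel_measurable lborel" and eq: "AE x in lborel. F x = F' x"
    using completion_ex_borel_measurable_real[OF borel_measurable_integrable[OF F]] by blast
  have eqL: "AE x in lebesgue. F x = F' x" using eq by (rule AE_completion)
  have F'L: "integrable lebesgue F'"
    by (rule integrable_cong_AE_imp[OF F]) (use eqL in \<open>auto intro: measurable_completion\<close>)
  then have F'i: "integrable lborel F'" by (simp add: integrable_completion)
  have si: "set_integrable lborel A F'" if "A \<in> sets borel" for A
    unfolding set_integrable_def using F'i that by (intro integrable_mult_indicator) auto
  have box0: "(LINT x:box a b|lborel. F' x) = 0" for a b
  proof -
    have "(LINT x:box a b|lborel. F' x) = (LINT x:box a b|lebesgue. F' x)"
      unfolding set_lebesgue_integral_def by (rule integral_completion[symmetric]) measurable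
    also have "\<dots> = (LINT x:box a b|lebesgue. F x)"
      unfolding set_lebesgue_integral_def
    proof (rule integral_cong_AE)
      show "AE x in lebesgue. indicat_real (box a b) x *\<^sub>R F' x = indicat_real (box a b) x *\<^sub>R F x"
        using eqL by eventually_elim simp
      show "(\<lambda>x. indicat_real (box a b) x *\<^sub>R F' x) \<in> borel_measurable lebesgue"
        by (rule measurable_completion) measurable
      show "(\<lambda>x. indicat_real (box a b) x *\<^sub>R F x) \<in> borel_measurable lebesgue"
        by (intro borel_measurable_scaleR borel_measurable_indicator borel_measurable_integrable[OF F])
           (simp add: sets_completionI_sets)
    qed
    finally show ?thesis using boxes by simp
  qed
  have total: "(LINT x|lborel. F' x) = 0"
  proof -
    let ?B = "\<lambda>n::nat. box (- (real n *\<^sub>R One)) (real n *\<^sub>R One) :: 'a set"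
    have "(\<lambda>n. LINT x|lborel. indicator (?B n) x * F' x) \<longlonglongrightarrow> (LINT x|lborel. F' x)"
    proof (rule integral_dominated_convergence[where w = "\<lambda>x. \<bar>F' x\<bar>"])
      show "AE x in lborel. (\<lambda>n. indicator (?B n) x * F' x) \<longlonglongrightarrow> F' x"
      proof (intro AE_I2 tendsto_eventually)
        fix x :: 'a
        have "x \<in> (\<Union>n. ?B n)" by (simp add: UN_box_eq_UNIV)
        then obtain N where N: "x \<in> ?B N" by blast
        show "\<forall>\<^sub>F n in sequentially. indicator (?B n) x * F' x = F' x"
          using eventually_ge_at_top[of N]
        proof eventually_elim
          case (elim n)
          then have "real N \<le> real n" by simp
          then have "x \<in> ?B n" using N by (force simp: mem_box inner_simps)
          then show ?case by simp
        qed
      qed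
    qed (use F'i in \<open>auto simp: indicator_def\<close>)
    then show ?thesis using box0 by (simp add: set_lebesgue_integral_def LIMSEQ_const_iff)
  qed
  have zero: "(LINT x:A|lborel. F' x) = 0" if "A \<in> sets lborel" for A
  proof -
    have AS: "A \<in> sigma_sets UNIV (range (\<lambda>(a, b). box a b :: 'a set))"
      using that by (simp add: borel_eq_box)
    have IS: "Int_stable (range (\<lambda>(a, b). box a b :: 'a set))"
      by (auto simp: Int_stable_def box_Int_box)
    have GP: "range (\<lambda>(a, b). box a b :: 'a set) \<subseteq> Pow UNIV" by simp
    show ?thesis using IS GP AS
    proof (induction A rule: sigma_sets_induct_disjoint)
      case (basic A)
      then show ?case using box0 by auto
    next
      case empty
      then show ?case by (simp add: set_lebesgue_integral_def)
    next
      case (compl A)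
      have "A \<in> sets borel" using compl(1) by (simp add: borel_eq_box)
      have "(LINT x:UNIV - A|lborel. F' x) = (LINT x|lborel. F' x) - (LINT x:A|lborel. F' x)"
      proof -
        have "(\<lambda>x. indicator (UNIV - A) x *\<^sub>R F' x) = (\<lambda>x. F' x - indicator A x *\<^sub>R F' x)"
          by (auto simp: indicator_def fun_eq_iff)
        then show ?thesis
          unfolding set_lebesgue_integral_def
          using F'i si[OF \<open>A \<in> sets borel\<close>] by (simp add: set_integrable_def)
      qed
      with compl(2) total show ?case by simp
    next
      case (union A)
      have A: "A i \<in> sets borel" for i using union(2) by (auto simp: borel_eq_box)
      have "(LINT x:(\<Union>i. A i)|lborel. F' x) = (\<Sum>i. (LINT x:A i|lborel. F' x))"
        by (rule lebesgue_integral_countable_add)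
           (use A union(1) si in \<open>auto simp: disjoint_family_on_def\<close>)
      with union(3) show ?case by simp
    qed
  qed
  have "AE x in lborel. F' x = 0"
    by (rule density_unique_real) (use F'i zero in \<open>auto simp: set_lebesgue_integral_def\<close>)
  then have "AE x in lebesgue. F' x = 0" by (rule AE_completion)
  with eqL show ?thesis by eventually_elim simp
qed

text \<open>The integral of \<open>h\<close> vanishes over every box whose closure lies in \<open>\<Omega>\<close>, and countably many
  such boxes cover \<open>\<Omega>\<close>.\<close>

lemma fundamental_lemma_calculus_of_variations:
  fixes h :: "'a::euclidean_space \<Rightarrow> real"
  assumes "open \<Omega>" and int: "locally_integrable \<Omega> h"
    and zero: "\<And>\<phi>. \<phi> \<in> test_functions \<Omega> \<Longrightarrow> (LINT x:\<Omega>|lebesgue. h x * \<phi> x) = 0"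
  shows "AE x in lebesgue. x \<in> \<Omega> \<longrightarrow> h x = 0"
proof -
  have local: "AE x in lebesgue. x \<in> box c d \<longrightarrow> h x = 0" if cd: "cbox c d \<subseteq> \<Omega>" for c d
  proof -
    have "AE x in lebesgue. indicator (box c d) x * h x = 0"
    proof (rule AE_eq_0_if_integral_boxes_eq_0)
      have "h absolutely_integrable_on cbox c d"
        using int cd by (auto simp: locally_integrable_def compact_cbox)
      then have "h absolutely_integrable_on box c d"
        by (rule set_integrable_subset) (auto intro: box_subset_cbox[THEN subsetD])
      then show "integrable lebesgue (\<lambda>x. indicator (box c d) x * h x)"
        by (simp add: set_integrable_def)
      fix a b
      obtain e f where ef: "box a b \<inter> box c d = box e f" using box_Int_box by blast
      show "(LINT x:box a b|lebesgue. indicator (box c d) x * h x) = 0"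
      proof (cases "box e f = {}")
        case True
        then have "(\<lambda>x. indicator (box a b) x * (indicator (box c d) x * h x)) = (\<lambda>x. 0)"
          using ef by (auto simp: indicator_def fun_eq_iff)
        then show ?thesis by (simp add: set_lebesgue_integral_def)
      next
        case False
        then have "cbox e f \<subseteq> cbox c d"
          using ef closure_box[of e f] closure_mono[of "box e f" "cbox c d"] box_subset_cbox[of c d] by auto
        then have "(LINT x:box e f|lebesgue. h x) = 0"
          using integral_eq_0_on_box[OF int zero] cd by blast
        moreover have "(\<lambda>x. indicator (box a b) x * (indicator (box c d) x * h x)) = (\<lambda>x. indicator (box e f) x * h x)"
          unfolding ef[symmetric] by (auto simp: indicator_def fun_eq_iff)
        ultimately show ?thesis by (simp add: set_lebesgue_integral_def)
      qed
    qed
    then show ?thesis by eventually_elim (auto simp: indicator_def)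
  qed
  define \<F> where "\<F> = {box c d | c d. cbox c d \<subseteq> \<Omega>}"
  have "\<Union>\<F> = \<Omega>"
  proof
    show "\<Union>\<F> \<subseteq> \<Omega>" unfolding \<F>_def using box_subset_cbox by blast
    show "\<Omega> \<subseteq> \<Union>\<F>"
    proof
      fix x assume "x \<in> \<Omega>"
      then obtain a b where "cbox a b \<subseteq> \<Omega>" "x \<in> box a b" using open_contains_cbox[OF \<open>open \<Omega>\<close>] by metis
      then show "x \<in> \<Union>\<F>" unfolding \<F>_def by blast
    qed
  qed
  moreover obtain \<F>' where \<F>': "\<F>' \<subseteq> \<F>" "countable \<F>'" "\<Union>\<F>' = \<Union>\<F>"
    using Lindelof[of \<F>] unfolding \<F>_def by (auto simp: open_box)
  moreover have "AE x in lebesgue. \<forall>B\<in>\<F>'. x \<in> B \<longrightarrow> h x = 0"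
    using \<F>'(1,2) local unfolding \<F>_def by (subst AE_ball_countable) auto
  ultimately show ?thesis by (auto elim!: eventually_mono)
qed

section \<open>Weak gradients of locally Lipschitz functions\<close>

text \<open>The radius is uniform over a compact set, which is what bounds difference quotients with a
  common step on the support of a test function.\<close>

definition locally_Lipschitz :: "'a::euclidean_space set \<Rightarrow> ('a \<Rightarrow> real) \<Rightarrow> bool" where
  "locally_Lipschitz \<Omega> u \<longleftrightarrow> (\<forall>K. compact K \<and> K \<subseteq> \<Omega> \<longrightarrow>
     (\<exists>r>0. \<exists>L. \<forall>x\<in>K. cball x r \<subseteq> \<Omega> \<and> (\<forall>y\<in>cball x r. \<bar>u y - u x\<bar> \<le> L * dist x y)))"

lemma locally_LipschitzE:
  assumes "locally_Lipschitz \<Omega> u" "compact K" "K \<subseteq> \<Omega>"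
  obtains r L where "0 < r" "\<And>x. x \<in> K \<Longrightarrow> cball x r \<subseteq> \<Omega>"
    "\<And>x y. x \<in> K \<Longrightarrow> y \<in> cball x r \<Longrightarrow> \<bar>u y - u x\<bar> \<le> L * dist x y"
proof -
  have "\<exists>r>0. \<exists>L. \<forall>x\<in>K. cball x r \<subseteq> \<Omega> \<and> (\<forall>y\<in>cball x r. \<bar>u y - u x\<bar> \<le> L * dist x y)"
    using assms unfolding locally_Lipschitz_def by simp
  then obtain r L where "0 < r"
    "\<forall>x\<in>K. cball x r \<subseteq> \<Omega> \<and> (\<forall>y\<in>cball x r. \<bar>u y - u x\<bar> \<le> L * dist x y)"
    by (elim exE conjE)
  then show thesis by (intro that[of r L]) simp_all
qed

lemma locally_Lipschitz_imp_continuous_on: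
  assumes "locally_Lipschitz \<Omega> u"
  shows "continuous_on \<Omega> u"
proof (rule continuous_at_imp_continuous_on, rule ballI)
  fix x assume "x \<in> \<Omega>"
  then have "{x} \<subseteq> \<Omega>" by simp
  then obtain r L where r: "r > 0" and L: "\<And>y. y \<in> cball x r \<Longrightarrow> \<bar>u y - u x\<bar> \<le> L * dist x y"
    by (rule locally_LipschitzE[OF assms compact_sing]) blast
  have "((\<lambda>y. u y - u x) \<longlongrightarrow> 0) (at x)"
  proof (rule Lim_null_comparison)
    show "\<forall>\<^sub>F y in at x. norm (u y - u x) \<le> L * dist x y"
      unfolding eventually_at using r L by (intro exI[of _ r]) (auto simp: dist_commute)
    have "((\<lambda>y. L * dist x y) \<longlongrightarrow> L * dist x x) (at x)" by (intro tendsto_intros)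
    then show "((\<lambda>y. L * dist x y) \<longlongrightarrow> 0) (at x)" by simp
  qed
  then show "isCont u x" by (simp add: isCont_def LIM_zero_iff)
qed

lemma integral_lborel_translate:
  fixes F :: "'a::euclidean_space \<Rightarrow> real"
  assumes [measurable]: "F \<in> borel_measurable borel"
  shows "(\<integral>x. F (x + c) \<partial>lborel) = (\<integral>x. F x \<partial>lborel)"
    and "integrable lborel (\<lambda>x. F (x + c)) \<longleftrightarrow> integrable lborel F"
proof -
  have "(\<integral>x. F x \<partial>lborel) = (\<integral>x. F x \<partial>distr lborel borel ((+) c))" by (simp add: lborel_distr_plus)
  also have "\<dots> = (\<integral>x. F (c + x) \<partial>lborel)" by (rule integral_distr) auto
  finally show "(\<integral>x. F (x + c) \<partial>lborel) = (\<integral>x. F x \<partial>lborel)" by (simp add: add.commute)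
  have "integrable lborel F \<longleftrightarrow> integrable (distr lborel borel ((+) c)) F" by (simp add: lborel_distr_plus)
  also have "\<dots> \<longleftrightarrow> integrable lborel (\<lambda>x. F (c + x))" by (rule integrable_distr_eq) auto
  finally show "integrable lborel (\<lambda>x. F (x + c)) \<longleftrightarrow> integrable lborel F" by (simp add: add.commute)
qed

lemma DERIV_along_line:
  assumes "\<phi> differentiable (at (y + t *\<^sub>R e))"
  shows "((\<lambda>t. \<phi> (y + t *\<^sub>R e)) has_real_derivative partial_deriv e \<phi> (y + t *\<^sub>R e)) (at t)"
proof -
  define D where "D = frechet_derivative \<phi> (at (y + t *\<^sub>R e))"
  have D: "(\<phi> has_derivative D) (at (y + t *\<^sub>R e))"
    using assms by (simp add: D_def frechet_derivative_works)
  have "((\<lambda>t. y + t *\<^sub>R e) has_derivative (\<lambda>s. s *\<^sub>R e)) (at t)"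
    by (auto intro!: derivative_eq_intros)
  from has_derivative_compose[OF this D]
  have "((\<lambda>t. \<phi> (y + t *\<^sub>R e)) has_derivative (\<lambda>s. D (s *\<^sub>R e))) (at t)" .
  moreover have "(\<lambda>s. D (s *\<^sub>R e)) = (*) (D e)"
    using linear_scale[OF has_derivative_linear[OF D]] by (auto simp: mult.commute)
  ultimately show ?thesis by (simp add: has_field_derivative_def D_def partial_deriv_def)
qed

lemma eq_0_outside_support: "x \<notin> closure {x. \<phi> x \<noteq> 0} \<Longrightarrow> \<phi> x = 0"
  using closure_subset[of "{x. \<phi> x \<noteq> 0}"] by blast

lemma test_function_difference_quotient:
  fixes \<phi> :: "'a::euclidean_space \<Rightarrow> real"
  assumes \<phi>: "\<phi> \<in> test_functions \<Omega>" and e: "e \<in> Basis"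
  shows "continuous_on UNIV \<phi>" "continuous_on UNIV (partial_deriv e \<phi>)"
    and "\<exists>B. \<forall>y s. \<bar>\<phi> (y + s *\<^sub>R e) - \<phi> y\<bar> \<le> B * \<bar>s\<bar>"
    and "((\<lambda>s. (\<phi> (y + s *\<^sub>R e) - \<phi> y) / s) \<longlongrightarrow> partial_deriv e \<phi> y) (at 0)"
proof -
  have "C_k 0 UNIV \<phi>" using \<phi> unfolding test_functions_def by blast
  then show "continuous_on UNIV \<phi>" by simp
  have "C_k (Suc 0) UNIV \<phi>" using \<phi> unfolding test_functions_def by blast
  then have diff: "\<And>x. \<phi> differentiable (at x)" and cont: "continuous_on UNIV (partial_deriv e \<phi>)"
    using e by auto
  show "continuous_on UNIV (partial_deriv e \<phi>)" by fact
  define K where "K = closure {x. \<phi> x \<noteq> 0}"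
  have "compact K" using \<phi> by (simp add: test_functions_def K_def)
  have out: "partial_deriv e \<phi> x = 0" if "x \<notin> K" for x
  proof -
    have "(\<phi> has_derivative (\<lambda>_. 0)) (at x)"
    proof (rule has_derivative_transform_within_open)
      show "((\<lambda>_. 0) has_derivative (\<lambda>_. 0)) (at x)" by (rule has_derivative_const)
      show "open (- K)" by (simp add: K_def open_Compl)
      show "x \<in> - K" using that by simp
      show "0 = \<phi> y" if "y \<in> - K" for y
        using that eq_0_outside_support[of y \<phi>] by (simp add: K_def)
    qed
    then show ?thesis by (rule partial_deriv_eqI)
  qed
  have "bounded (partial_deriv e \<phi> ` K)"
    by (intro compact_imp_bounded compact_continuous_image continuous_on_subset[OF cont] \<open>compact K\<close>) auto
  then obtain B where "\<And>x. x \<in> K \<Longrightarrow> \<bar>partial_deriv e \<phi> x\<bar> \<le> B"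
    unfolding bounded_iff by auto
  then have B: "\<bar>partial_deriv e \<phi> x\<bar> \<le> max B 0" for x
    using out[of x] by (cases "x \<in> K") (auto intro: max.coboundedI1)
  have "\<bar>\<phi> (y + s *\<^sub>R e) - \<phi> y\<bar> \<le> max B 0 * \<bar>s\<bar>" for y s
    using field_differentiable_bound[where S = UNIV and f = "\<lambda>t. \<phi> (y + t *\<^sub>R e)" and x = s and y = 0,
        OF _ DERIV_along_line[OF diff]] B by auto
  then show "\<exists>B. \<forall>y s. \<bar>\<phi> (y + s *\<^sub>R e) - \<phi> y\<bar> \<le> B * \<bar>s\<bar>" by blast
  show "((\<lambda>s. (\<phi> (y + s *\<^sub>R e) - \<phi> y) / s) \<longlongrightarrow> partial_deriv e \<phi> y) (at 0)"
    using DERIV_along_line[where y = y and t = 0 and e = e, OF diff] by (simp add: DERIV_def)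
qed

text \<open>Discrete integration by parts: a translation of the integral moves the difference quotient from
  \<open>u\<close> to \<open>\<phi>\<close>, where it converges boundedly to a derivative. The function \<open>u\<close> is extended by zero,
  so that translated arguments make sense everywhere; for small steps the test function only
  sees values inside \<open>\<Omega>\<close>.\<close>

lemma difference_quotient_weak_convergence:
  fixes u :: "'a::euclidean_space \<Rightarrow> real"
  assumes "open \<Omega>" and lip: "locally_Lipschitz \<Omega> u" and e: "e \<in> Basis"
    and \<phi>: "\<phi> \<in> test_functions \<Omega>"
  defines "v \<equiv> \<lambda>x. indicator \<Omega> x * u x"
  shows "(\<lambda>n. \<integral>x. real (Suc n) * (v (x + (1 / real (Suc n)) *\<^sub>R e) - v x) * \<phi> x \<partial>lborel)
     \<longlonglongrightarrow> - (\<integral>x. v x * partial_deriv e \<phi> x \<partial>lborel)"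
proof -
  have cont: "continuous_on \<Omega> u" using lip by (rule locally_Lipschitz_imp_continuous_on)
  have v_meas[measurable]: "v \<in> borel_measurable borel"
    using borel_measurable_continuous_on_indicator[OF _ cont] \<open>open \<Omega>\<close> by (simp add: v_def)
  have contv: "continuous_on \<Omega> v"
    by (rule continuous_on_eq[OF cont]) (auto simp: v_def)
  note tf = test_function_difference_quotient[OF \<phi> e]
  have [measurable]: "\<phi> \<in> borel_measurable borel" "partial_deriv e \<phi> \<in> borel_measurable borel"
    using tf by (auto intro: borel_measurable_continuous_onI)
  obtain B where B: "\<And>y s. \<bar>\<phi> (y + s *\<^sub>R e) - \<phi> y\<bar> \<le> B * \<bar>s\<bar>" using tf(3) by blast
  define K where "K = closure {x. \<phi> x \<noteq> 0}"
  have K: "compact K" "K \<subseteq> \<Omega>" using \<phi> by (auto simp: test_functions_def K_def)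
  have out: "\<phi> x = 0" if "x \<notin> K" for x using that unfolding K_def by (rule eq_0_outside_support)
  obtain r where r: "r > 0" "\<And>x. x \<in> K \<Longrightarrow> cball x r \<subseteq> \<Omega>"
    by (rule locally_LipschitzE[OF lip K]) blast
  define K' where "K' = {x + y | x y. x \<in> K \<and> y \<in> cball 0 r}"
  have K': "compact K'" unfolding K'_def by (intro compact_sums K compact_cball)
  have K'\<Omega>: "K' \<subseteq> \<Omega>" using r(2) unfolding K'_def by (force simp: dist_norm)
  have norm_e: "norm e = 1" using e by simp
  have inK': "y \<in> K'" if "y + s *\<^sub>R e \<in> K" "\<bar>s\<bar> \<le> r" for y s
    unfolding K'_def mem_Collect_eq
    by (rule exI[of _ "y + s *\<^sub>R e"], rule exI[of _ "- s *\<^sub>R e"]) (use that norm_e in auto)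
  have KK': "K \<subseteq> K'" using inK'[of _ 0] r(1) by auto
  have dom: "integrable lborel (\<lambda>x. indicator K' x * \<bar>v x\<bar> * c)" for c
  proof -
    have "continuous_on K' (\<lambda>x. \<bar>v x\<bar> * c)"
      by (intro continuous_intros continuous_on_subset[OF contv K'\<Omega>])
    from borel_integrable_compact[OF K' this] show ?thesis by (simp add: mult.assoc)
  qed
  have shift_int: "integrable lborel (\<lambda>x. v x * \<phi> (x + s *\<^sub>R e))" if s: "\<bar>s\<bar> \<le> r" for s
  proof -
    have "integrable lborel (\<lambda>x. indicator K' x *\<^sub>R (v x * \<phi> (x + s *\<^sub>R e)))"
      by (intro borel_integrable_compact K' continuous_on_mult continuous_on_subset[OF contv K'\<Omega>]
            continuous_on_compose2[OF tf(1)] continuous_intros) auto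
    moreover have "(\<lambda>x. indicator K' x *\<^sub>R (v x * \<phi> (x + s *\<^sub>R e))) = (\<lambda>x. v x * \<phi> (x + s *\<^sub>R e))"
      using inK'[OF _ s] out by (auto simp: fun_eq_iff indicator_def)
    ultimately show ?thesis by simp
  qed
  have h_lim: "(\<lambda>n. 1 / real (Suc n)) \<longlonglongrightarrow> 0" using LIMSEQ_inverse_real_of_nat by (simp add: inverse_eq_divide)
  have h_small: "\<forall>\<^sub>F n in sequentially. 1 / real (Suc n) < r"
    using order_tendstoD(2)[OF h_lim r(1)] .
  \<comment> \<open>The integrand after the translation.\<close>
  define q where "q n y = v y * (real (Suc n) * (\<phi> (y + (- 1 / real (Suc n)) *\<^sub>R e) - \<phi> y))" for n y
  have eq: "(\<integral>x. real (Suc n) * (v (x + (1 / real (Suc n)) *\<^sub>R e) - v x) * \<phi> x \<partial>lborel) = (\<integral>y. q n y \<partial>lborel)"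
    if n: "1 / real (Suc n) < r" for n
  proof -
    define h where "h = 1 / real (Suc n)"
    have h: "\<bar>h\<bar> \<le> r" "\<bar>- h\<bar> \<le> r" using n by (auto simp: h_def)
    define F where "F y = v y * \<phi> (y + (- h) *\<^sub>R e)" for y
    have [measurable]: "F \<in> borel_measurable borel" unfolding F_def by measurable
    have F_int: "integrable lborel F" unfolding F_def by (rule shift_int[OF h(2)])
    have G_int: "integrable lborel (\<lambda>x. v x * \<phi> x)" using shift_int[of 0] r(1) by simp
    have "(\<integral>x. real (Suc n) * (v (x + h *\<^sub>R e) - v x) * \<phi> x \<partial>lborel)
        = (\<integral>x. real (Suc n) * (F (x + h *\<^sub>R e) - v x * \<phi> x) \<partial>lborel)"
      unfolding F_def by (rule Bochner_Integration.integral_cong) (auto simp: algebra_simps)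
    also have "\<dots> = real (Suc n) * ((\<integral>x. F (x + h *\<^sub>R e) \<partial>lborel) - (\<integral>x. v x * \<phi> x \<partial>lborel))"
      using G_int F_int by (simp add: integral_lborel_translate(2)[of F "h *\<^sub>R e"] del: of_nat_Suc)
    also have "\<dots> = real (Suc n) * ((\<integral>x. F x \<partial>lborel) - (\<integral>x. v x * \<phi> x \<partial>lborel))"
      by (simp add: integral_lborel_translate(1)[of F "h *\<^sub>R e"])
    also have "\<dots> = (\<integral>x. real (Suc n) * (F x - v x * \<phi> x) \<partial>lborel)"
      using G_int F_int by (simp del: of_nat_Suc)
    also have "\<dots> = (\<integral>y. q n y \<partial>lborel)"
      unfolding F_def q_def h_def by (rule Bochner_Integration.integral_cong) (auto simp: algebra_simps)
    finally show ?thesis by (simp add: h_def)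
  qed
  obtain N where N: "\<And>n. n \<ge> N \<Longrightarrow> 1 / real (Suc n) < r"
    using h_small by (auto simp: eventually_sequentially)
  \<comment> \<open>Only the indices from \<open>N\<close> on have steps below \<open>r\<close>, for which \<open>q n\<close> lives on \<open>K'\<close>.\<close>
  have "(\<lambda>n. \<integral>y. q (n + N) y \<partial>lborel) \<longlonglongrightarrow> (\<integral>y. v y * - partial_deriv e \<phi> y \<partial>lborel)"
  proof (rule integral_dominated_convergence[where w = "\<lambda>x. indicator K' x * \<bar>v x\<bar> * \<bar>B\<bar>"])
    show "AE y in lborel. (\<lambda>n. q (n + N) y) \<longlonglongrightarrow> v y * - partial_deriv e \<phi> y"
    proof (rule AE_I2)
      fix y
      have "filterlim (\<lambda>n. - 1 / real (Suc n)) (at 0) sequentially"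
        unfolding filterlim_at using tendsto_minus[OF h_lim] by auto
      from tendsto_mult_left[OF tendsto_minus[OF filterlim_compose[OF tf(4)[of y] this]], of "v y"]
      have "(\<lambda>n. q n y) \<longlonglongrightarrow> v y * - partial_deriv e \<phi> y"
        unfolding q_def by (simp add: algebra_simps del: of_nat_Suc)
      then show "(\<lambda>n. q (n + N) y) \<longlonglongrightarrow> v y * - partial_deriv e \<phi> y"
        by (rule LIMSEQ_ignore_initial_segment)
    qed
    show "AE y in lborel. norm (q (n + N) y) \<le> indicator K' y * \<bar>v y\<bar> * \<bar>B\<bar>" for n
    proof (rule AE_I2)
      fix y
      define s where "s = - 1 / real (Suc (n + N))"
      have s: "\<bar>s\<bar> \<le> r" "\<bar>s\<bar> * real (Suc (n + N)) = 1" using N[of "n + N"] by (auto simp: s_def)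
      show "norm (q (n + N) y) \<le> indicator K' y * \<bar>v y\<bar> * \<bar>B\<bar>"
      proof (cases "y \<in> K'")
        case True
        have "real (Suc (n + N)) * \<bar>\<phi> (y + s *\<^sub>R e) - \<phi> y\<bar> \<le> real (Suc (n + N)) * (B * \<bar>s\<bar>)"
          by (intro mult_left_mono B) simp
        also have "\<dots> = B" using s(2) by (metis mult.left_commute mult.commute mult_1)
        finally have "real (Suc (n + N)) * \<bar>\<phi> (y + s *\<^sub>R e) - \<phi> y\<bar> \<le> \<bar>B\<bar>" by linarith
        then have "\<bar>v y\<bar> * (real (Suc (n + N)) * \<bar>\<phi> (y + s *\<^sub>R e) - \<phi> y\<bar>) \<le> \<bar>v y\<bar> * \<bar>B\<bar>"
          by (rule mult_left_mono) simp
        then show ?thesis using True unfolding q_def s_def[symmetric] by (simp add: abs_mult)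
      next
        case False
        then have "\<phi> (y + s *\<^sub>R e) = 0" "\<phi> y = 0" using inK'[OF _ s(1)] KK' out by blast+
        then show ?thesis unfolding q_def s_def[symmetric] by simp
      qed
    qed
    show "q (n + N) \<in> borel_measurable lborel" for n unfolding q_def by measurable
    show "integrable lborel (\<lambda>x. indicator K' x * \<bar>v x\<bar> * \<bar>B\<bar>)" by (rule dom)
  qed measurable
  then have "(\<lambda>n. \<integral>y. q n y \<partial>lborel) \<longlonglongrightarrow> - (\<integral>y. v y * partial_deriv e \<phi> y \<partial>lborel)"
    by (auto intro: LIMSEQ_offset)
  then show ?thesis
    by (rule Lim_transform_eventually) (use h_small in eventually_elim, simp add: eq del: of_nat_Suc)
qed

text \<open>A weak limit of the difference quotients in direction \<open>e\<close> is a weak partial derivative. A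
  Lipschitz bound of \<open>u\<close> at a single point \<open>x\<close> bounds the difference quotients at \<open>x\<close> with small
  steps, and such bounds pass to the weak limit.\<close>

lemma weak_partial_derivative_exists:
  fixes u :: "'a::euclidean_space \<Rightarrow> real"
  assumes "open \<Omega>" and lip: "locally_Lipschitz \<Omega> u" and e: "e \<in> Basis"
  obtains g where "g \<in> borel_measurable borel"
    and "\<And>x r c. 0 < r \<Longrightarrow> ball x r \<subseteq> \<Omega> \<Longrightarrow> (\<And>y. y \<in> ball x r \<Longrightarrow> \<bar>u y - u x\<bar> \<le> c * dist x y)
      \<Longrightarrow> \<bar>g x\<bar> \<le> c"
    and "\<And>\<phi>. \<phi> \<in> test_functions \<Omega> \<Longrightarrow>
      (LINT x:\<Omega>|lebesgue. u x * partial_deriv e \<phi> x) = - (LINT x:\<Omega>|lebesgue. g x * \<phi> x)"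
proof -
  have cont: "continuous_on \<Omega> u" using lip by (rule locally_Lipschitz_imp_continuous_on)
  define v where "v x = indicator \<Omega> x * u x" for x
  have v_meas[measurable]: "v \<in> borel_measurable borel"
    using borel_measurable_continuous_on_indicator[OF _ cont] \<open>open \<Omega>\<close> by (simp add: v_def[abs_def])
  have [measurable]: "\<Omega> \<in> sets borel" using \<open>open \<Omega>\<close> by simp
  define f where "f n x = indicator \<Omega> x * (real (Suc n) * (v (x + (1 / real (Suc n)) *\<^sub>R e) - v x))" for n x
  have f_meas: "f n \<in> borel_measurable lborel" for n unfolding f_def by measurable
  have f_le: "\<bar>f n x\<bar> \<le> c" if "x \<in> \<Omega>" "1 / real (Suc n) < r" "ball x r \<subseteq> \<Omega>"
    "\<And>y. y \<in> ball x r \<Longrightarrow> \<bar>u y - u x\<bar> \<le> c * dist x y" for n x r c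
  proof -
    define y where "y = x + (1 / real (Suc n)) *\<^sub>R e"
    have d: "dist x y = 1 / real (Suc n)" using e by (simp add: y_def dist_norm)
    then have y: "y \<in> ball x r" using that by simp
    have "\<bar>f n x\<bar> = real (Suc n) * \<bar>u y - u x\<bar>"
      using that y unfolding f_def y_def[symmetric] v_def by (auto simp: abs_mult)
    also have "\<dots> \<le> real (Suc n) * (c * dist x y)" by (intro mult_left_mono that y) simp
    also have "\<dots> = c" unfolding d by (simp del: of_nat_Suc)
    finally show ?thesis .
  qed
  have small: "\<exists>N. \<forall>n\<ge>N. 1 / real (Suc n) < r" if "0 < r" for r :: real
    using order_tendstoD(2)[OF LIMSEQ_inverse_real_of_nat that]
    by (simp add: inverse_eq_divide eventually_sequentially)
  have uniform: "\<exists>N B. \<forall>n\<ge>N. \<forall>x\<in>K. \<bar>f n x\<bar> \<le> B" if K: "compact K" "K \<subseteq> \<Omega>" for K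
  proof -
    obtain r L where r: "r > 0" and *: "\<And>x. x \<in> K \<Longrightarrow> cball x r \<subseteq> \<Omega>"
      "\<And>x y. x \<in> K \<Longrightarrow> y \<in> cball x r \<Longrightarrow> \<bar>u y - u x\<bar> \<le> L * dist x y"
      by (rule locally_LipschitzE[OF lip K]) blast
    obtain N where "\<And>n. n \<ge> N \<Longrightarrow> 1 / real (Suc n) < r" using small[OF r] by blast
    then have "\<forall>n\<ge>N. \<forall>x\<in>K. \<bar>f n x\<bar> \<le> L"
      using * K(2) by (intro allI impI ballI f_le[of _ _ r]) force+
    then show ?thesis by blast
  qed
  have bdd: "bdd_above (range (\<lambda>n. \<bar>f n x\<bar>))" for x
  proof (cases "x \<in> \<Omega>")
    case True
    then obtain N B where "\<And>n. n \<ge> N \<Longrightarrow> \<bar>f n x\<bar> \<le> B" using uniform[of "{x}"] by auto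
    then have "bdd_above ((\<lambda>n. \<bar>f n x\<bar>) ` {N..})" by (intro bdd_aboveI[of _ B]) auto
    moreover have "bdd_above ((\<lambda>n. \<bar>f n x\<bar>) ` {..<N})" by simp
    ultimately have "bdd_above ((\<lambda>n. \<bar>f n x\<bar>) ` ({..<N} \<union> {N..}))" by (simp add: image_Un)
    moreover have "{..<N} \<union> {N..} = UNIV" by auto
    ultimately show ?thesis by simp
  next
    case False
    then show ?thesis by (simp add: f_def)
  qed
  obtain g where g_meas[measurable]: "g \<in> borel_measurable lborel"
    and g_le: "\<And>x c N. (\<And>n. n \<ge> N \<Longrightarrow> \<bar>f n x\<bar> \<le> c) \<Longrightarrow> \<bar>g x\<bar> \<le> c"
    and g_lim: "\<And>\<psi> l B N. integrable lborel \<psi> \<Longrightarrow>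
       (\<And>n x. n \<ge> N \<Longrightarrow> \<psi> x \<noteq> 0 \<Longrightarrow> \<bar>f n x\<bar> \<le> B) \<Longrightarrow>
       (\<lambda>n. \<integral>x. f n x * \<psi> x \<partial>lborel) \<longlonglongrightarrow> l \<Longrightarrow> (\<integral>x. g x * \<psi> x \<partial>lborel) = l"
    using weak_limit_of_bounded_sequence[OF sigma_finite_lborel f_meas bdd] by blast
  show thesis
  proof
    show "g \<in> borel_measurable borel" using g_meas by simp
  next
    fix x r c assume r: "0 < r" "ball x r \<subseteq> \<Omega>" "\<And>y. y \<in> ball x r \<Longrightarrow> \<bar>u y - u x\<bar> \<le> c * dist x y"
    then have "x \<in> \<Omega>" by auto
    obtain N where "\<And>n. n \<ge> N \<Longrightarrow> 1 / real (Suc n) < r" using small[OF r(1)] by blast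
    then show "\<bar>g x\<bar> \<le> c" using f_le[OF \<open>x \<in> \<Omega>\<close> _ r(2,3)] by (intro g_le[of N]) auto
  next
    fix \<phi> assume \<phi>: "\<phi> \<in> test_functions \<Omega>"
    define K where "K = closure {x. \<phi> x \<noteq> 0}"
    have K: "compact K" "K \<subseteq> \<Omega>" using \<phi> by (auto simp: test_functions_def K_def)
    have out: "\<phi> x = 0" if "x \<notin> K" for x using that unfolding K_def by (rule eq_0_outside_support)
    note tf = test_function_difference_quotient[OF \<phi> e]
    have [measurable]: "\<phi> \<in> borel_measurable borel" "partial_deriv e \<phi> \<in> borel_measurable borel"
      using tf by (auto intro: borel_measurable_continuous_onI)
    have \<phi>_int: "integrable lborel \<phi>"
    proof -
      have "integrable lborel (\<lambda>x. indicator K x *\<^sub>R \<phi> x)"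
        using borel_integrable_compact[OF K(1) continuous_on_subset[OF tf(1)]] by simp
      moreover have "(\<lambda>x. indicator K x *\<^sub>R \<phi> x) = \<phi>" using out by (auto simp: fun_eq_iff indicator_def)
      ultimately show ?thesis by simp
    qed
    obtain N B where NB: "\<And>n x. n \<ge> N \<Longrightarrow> x \<in> K \<Longrightarrow> \<bar>f n x\<bar> \<le> B" using uniform[OF K] by blast
    have "(\<lambda>n. \<integral>x. f n x * \<phi> x \<partial>lborel) \<longlonglongrightarrow> - (\<integral>x. v x * partial_deriv e \<phi> x \<partial>lborel)"
    proof -
      have "(\<lambda>x. f n x * \<phi> x) = (\<lambda>x. real (Suc n) * (v (x + (1 / real (Suc n)) *\<^sub>R e) - v x) * \<phi> x)" for n
        unfolding f_def using out K(2) by (auto simp: fun_eq_iff indicator_def)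
      then show ?thesis
        using difference_quotient_weak_convergence[OF \<open>open \<Omega>\<close> lip e \<phi>] by (simp add: v_def)
    qed
    then have main: "(\<integral>x. g x * \<phi> x \<partial>lborel) = - (\<integral>x. v x * partial_deriv e \<phi> x \<partial>lborel)"
      by (intro g_lim[OF \<phi>_int, of N B]) (use NB out in blast)+
    have "(LINT x:\<Omega>|lebesgue. u x * partial_deriv e \<phi> x) = (\<integral>x. v x * partial_deriv e \<phi> x \<partial>lebesgue)"
      by (simp add: set_lebesgue_integral_def v_def mult.assoc)
    also have "\<dots> = (\<integral>x. v x * partial_deriv e \<phi> x \<partial>lborel)" by (rule integral_completion) measurable
    also have "\<dots> = - (\<integral>x. g x * \<phi> x \<partial>lborel)" using main by simp
    also have "(\<integral>x. g x * \<phi> x \<partial>lborel) = (\<integral>x. g x * \<phi> x \<partial>lebesgue)"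
      by (rule integral_completion[symmetric]) measurable
    also have "\<dots> = (LINT x:\<Omega>|lebesgue. g x * \<phi> x)"
      unfolding set_lebesgue_integral_def
      by (rule Bochner_Integration.integral_cong) (use out K(2) in \<open>auto simp: indicator_def\<close>)
    finally show "(LINT x:\<Omega>|lebesgue. u x * partial_deriv e \<phi> x) = - (LINT x:\<Omega>|lebesgue. g x * \<phi> x)" .
  qed
qed

lemma absolutely_integrable_on_compact_bounded:
  fixes g :: "'a::euclidean_space \<Rightarrow> real"
  assumes [measurable]: "(\<lambda>x. indicator K x * g x) \<in> borel_measurable borel" and "compact K"
    and "\<And>x. x \<in> K \<Longrightarrow> \<bar>g x\<bar> \<le> c"
  shows "g absolutely_integrable_on K"
proof -
  have "integrable lborel (\<lambda>x. indicator K x * g x)"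
  proof (rule Bochner_Integration.integrable_bound)
    show "integrable lborel (\<lambda>x. indicator K x *\<^sub>R c)" by (rule borel_integrable_compact) (use assms in auto)
    show "AE x in lborel. norm (indicator K x * g x) \<le> norm (indicator K x *\<^sub>R c)"
      using assms(3) by (intro AE_I2) (force simp: indicator_def)
  qed measurable
  then show ?thesis by (simp add: set_integrable_def integrable_completion)
qed

lemma weak_gradient_exists:
  fixes u :: "'a::euclidean_space \<Rightarrow> real"
  assumes "open \<Omega>" and lip: "locally_Lipschitz \<Omega> u"
  obtains G where "has_weak_gradient \<Omega> u G"
    and "\<And>x r c i. 0 < r \<Longrightarrow> ball x r \<subseteq> \<Omega> \<Longrightarrow> (\<And>y. y \<in> ball x r \<Longrightarrow> \<bar>u y - u x\<bar> \<le> c * dist x y)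
      \<Longrightarrow> i \<in> Basis \<Longrightarrow> \<bar>G x \<bullet> i\<bar> \<le> c"
proof -
  have cont: "continuous_on \<Omega> u" using lip by (rule locally_Lipschitz_imp_continuous_on)
  define P where "P e g \<longleftrightarrow> g \<in> borel_measurable borel
    \<and> (\<forall>x r c. 0 < r \<longrightarrow> ball x r \<subseteq> \<Omega> \<longrightarrow> (\<forall>y\<in>ball x r. \<bar>u y - u x\<bar> \<le> c * dist x y) \<longrightarrow> \<bar>g x\<bar> \<le> c)
    \<and> (\<forall>\<phi>\<in>test_functions \<Omega>.
        (LINT x:\<Omega>|lebesgue. u x * partial_deriv e \<phi> x) = - (LINT x:\<Omega>|lebesgue. g x * \<phi> x))" for e g
  have "\<forall>e\<in>Basis. \<exists>g. P e g"
  proof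
    fix e :: 'a assume e: "e \<in> Basis"
    show "\<exists>g. P e g"
    proof (rule weak_partial_derivative_exists[OF assms e])
      fix g assume "g \<in> borel_measurable borel"
        and "\<And>x r c. 0 < r \<Longrightarrow> ball x r \<subseteq> \<Omega> \<Longrightarrow> (\<And>y. y \<in> ball x r \<Longrightarrow> \<bar>u y - u x\<bar> \<le> c * dist x y)
          \<Longrightarrow> \<bar>g x\<bar> \<le> c"
        and "\<And>\<phi>. \<phi> \<in> test_functions \<Omega> \<Longrightarrow>
          (LINT x:\<Omega>|lebesgue. u x * partial_deriv e \<phi> x) = - (LINT x:\<Omega>|lebesgue. g x * \<phi> x)"
      then have "P e g" unfolding P_def by blast
      then show "\<exists>g. P e g" by (rule exI[of _ g])
    qed
  qed
  then obtain g where g: "\<forall>e\<in>Basis. P e (g e)" by (rule bchoice[THEN exE])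
  have g_meas: "g e \<in> borel_measurable borel" if "e \<in> Basis" for e
    using g that unfolding P_def by blast
  have g_le: "\<bar>g e x\<bar> \<le> c" if "e \<in> Basis" "0 < r" "ball x r \<subseteq> \<Omega>"
      "\<And>y. y \<in> ball x r \<Longrightarrow> \<bar>u y - u x\<bar> \<le> c * dist x y" for e x r c
    using bspec[OF g that(1), unfolded P_def] that(2-4) by blast
  have g_weak: "(LINT x:\<Omega>|lebesgue. u x * partial_deriv e \<phi> x) = - (LINT x:\<Omega>|lebesgue. g e x * \<phi> x)"
    if "e \<in> Basis" "\<phi> \<in> test_functions \<Omega>" for e \<phi>
    using g that unfolding P_def by blast
  define G where "G x = (\<Sum>e\<in>Basis. g e x *\<^sub>R e)" for x
  have G_inner: "G x \<bullet> i = g i x" if "i \<in> Basis" for x i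
    using that by (simp add: G_def)
  have u_loc: "locally_integrable \<Omega> u"
    unfolding locally_integrable_def
  proof (intro allI impI, elim conjE)
    fix K assume K: "compact K" "K \<subseteq> \<Omega>"
    have "integrable lborel (\<lambda>x. indicator K x *\<^sub>R u x)"
      by (intro borel_integrable_compact K continuous_on_subset[OF cont])
    then show "u absolutely_integrable_on K"
      unfolding set_integrable_def by (subst integrable_completion) auto
  qed
  have G_loc: "locally_integrable \<Omega> G"
    unfolding locally_integrable_def
  proof (intro allI impI, elim conjE)
    fix K assume K: "compact K" "K \<subseteq> \<Omega>"
    obtain r L where r: "r > 0" and L: "\<And>x. x \<in> K \<Longrightarrow> cball x r \<subseteq> \<Omega>"
      "\<And>x y. x \<in> K \<Longrightarrow> y \<in> cball x r \<Longrightarrow> \<bar>u y - u x\<bar> \<le> L * dist x y"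
      by (rule locally_LipschitzE[OF lip K]) blast
    have "g e absolutely_integrable_on K" if e: "e \<in> Basis" for e
    proof (rule absolutely_integrable_on_compact_bounded[OF _ K(1)])
      have [measurable]: "g e \<in> borel_measurable borel" "K \<in> sets borel" using g_meas[OF e] K(1) by (auto simp: borel_compact)
      show "(\<lambda>x. indicator K x * g e x) \<in> borel_measurable borel" by measurable
      fix x assume "x \<in> K"
      then show "\<bar>g e x\<bar> \<le> L"
        using L ball_subset_cball[of x r] by (intro g_le[OF e r]) blast+
    qed
    then have "(\<lambda>x. \<Sum>e\<in>Basis. g e x *\<^sub>R e) absolutely_integrable_on K"
      by (intro absolutely_integrable_sum absolutely_integrable_scaleR_left) auto
    then show "G absolutely_integrable_on K" by (simp add: G_def[abs_def])
  qed
  show thesis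
  proof
    show "has_weak_gradient \<Omega> u G"
      unfolding has_weak_gradient_def using u_loc G_loc g_weak by (simp add: G_inner)
    show "\<bar>G x \<bullet> i\<bar> \<le> c" if "0 < r" "ball x r \<subseteq> \<Omega>" "\<And>y. y \<in> ball x r \<Longrightarrow> \<bar>u y - u x\<bar> \<le> c * dist x y"
      "i \<in> Basis" for x r c i
      using g_le[OF that(4,1,2,3)] that(4) by (simp add: G_inner)
  qed
qed

text \<open>The difference of two weak gradients is orthogonal to all test functions.\<close>

lemma weak_gradient_unique:
  fixes u :: "'a::euclidean_space \<Rightarrow> real"
  assumes "open \<Omega>" and G: "has_weak_gradient \<Omega> u G" and H: "has_weak_gradient \<Omega> u H" and i: "i \<in> Basis"
  shows "AE x in lebesgue. x \<in> \<Omega> \<longrightarrow> G x \<bullet> i = H x \<bullet> i"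
proof -
  have GK: "G absolutely_integrable_on K" and HK: "H absolutely_integrable_on K" if "compact K" "K \<subseteq> \<Omega>" for K
    using G H that by (auto simp: has_weak_gradient_def locally_integrable_def)
  have *: "integrable lebesgue (\<lambda>x. indicator \<Omega> x * ((F x \<bullet> i) * \<phi> x))"
    if F: "has_weak_gradient \<Omega> u F" and \<phi>: "\<phi> \<in> test_functions \<Omega>" for F \<phi>
  proof -
    define K where "K = closure {x. \<phi> x \<noteq> 0}"
    have K: "compact K" "K \<subseteq> \<Omega>" using \<phi> by (auto simp: test_functions_def K_def)
    have out: "\<phi> x = 0" if "x \<notin> K" for x using that unfolding K_def by (rule eq_0_outside_support)
    note tf = test_function_difference_quotient[OF \<phi> i]
    have [measurable]: "\<phi> \<in> borel_measurable borel" using tf by (auto intro: borel_measurable_continuous_onI)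
    obtain B where B: "\<And>x. x \<in> K \<Longrightarrow> \<bar>\<phi> x\<bar> \<le> B"
      using compact_imp_bounded[OF compact_continuous_image[OF continuous_on_subset[OF tf(1)] K(1)]]
      unfolding bounded_iff by auto
    have FK: "integrable lebesgue (\<lambda>x. indicator K x *\<^sub>R F x)"
      using F K by (auto simp: has_weak_gradient_def locally_integrable_def set_integrable_def)
    have int: "integrable lebesgue (\<lambda>x. (indicator K x *\<^sub>R F x) \<bullet> i)"
      using FK by (rule integrable_inner_left) 
    then have [measurable]: "(\<lambda>x. (indicator K x *\<^sub>R F x) \<bullet> i) \<in> borel_measurable lebesgue" by auto
    have [measurable]: "\<phi> \<in> borel_measurable lebesgue" by (rule measurable_completion) measurable
    have "integrable lebesgue (\<lambda>x. ((indicator K x *\<^sub>R F x) \<bullet> i) * \<phi> x)"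
    proof (rule Bochner_Integration.integrable_bound)
      show "integrable lebesgue (\<lambda>x. B * ((indicator K x *\<^sub>R F x) \<bullet> i))" using int by simp
      show "AE x in lebesgue. norm (((indicator K x *\<^sub>R F x) \<bullet> i) * \<phi> x) \<le> norm (B * ((indicator K x *\<^sub>R F x) \<bullet> i))"
      proof (rule AE_I2)
        fix x
        show "norm (((indicator K x *\<^sub>R F x) \<bullet> i) * \<phi> x) \<le> norm (B * ((indicator K x *\<^sub>R F x) \<bullet> i))"
        proof (cases "x \<in> K")
          case True
          then have "\<bar>\<phi> x\<bar> \<le> \<bar>B\<bar>" using B[OF True] by linarith
          then show ?thesis by (simp add: abs_mult mult.commute mult_right_mono)
        qed simp
      qed
    qed measurable
    moreover have "(\<lambda>x. ((indicator K x *\<^sub>R F x) \<bullet> i) * \<phi> x) = (\<lambda>x. indicator \<Omega> x * ((F x \<bullet> i) * \<phi> x))"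
      using out K(2) by (auto simp: fun_eq_iff indicator_def)
    ultimately show ?thesis by simp
  qed
  have "AE x in lebesgue. x \<in> \<Omega> \<longrightarrow> G x \<bullet> i - H x \<bullet> i = 0"
  proof (rule fundamental_lemma_calculus_of_variations[OF \<open>open \<Omega>\<close>])
    show "locally_integrable \<Omega> (\<lambda>x. G x \<bullet> i - H x \<bullet> i)"
      unfolding locally_integrable_def
    proof (intro allI impI, elim conjE)
      fix K assume K: "compact K" "K \<subseteq> \<Omega>"
      have "integrable lebesgue (\<lambda>x. (indicator K x *\<^sub>R G x) \<bullet> i - (indicator K x *\<^sub>R H x) \<bullet> i)"
        using GK[OF K] HK[OF K] unfolding set_integrable_def
        by (intro Bochner_Integration.integrable_diff integrable_inner_left)
      then show "(\<lambda>x. G x \<bullet> i - H x \<bullet> i) absolutely_integrable_on K"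
        by (simp add: set_integrable_def right_diff_distrib)
    qed
    fix \<phi> assume \<phi>: "\<phi> \<in> test_functions \<Omega>"
    have "(\<lambda>x. indicator \<Omega> x * ((G x \<bullet> i - H x \<bullet> i) * \<phi> x))
        = (\<lambda>x. indicator \<Omega> x * ((G x \<bullet> i) * \<phi> x) - indicator \<Omega> x * ((H x \<bullet> i) * \<phi> x))"
      by (auto simp: fun_eq_iff algebra_simps)
    then have "(LINT x:\<Omega>|lebesgue. (G x \<bullet> i - H x \<bullet> i) * \<phi> x)
        = (LINT x:\<Omega>|lebesgue. (G x \<bullet> i) * \<phi> x) - (LINT x:\<Omega>|lebesgue. (H x \<bullet> i) * \<phi> x)"
      using *[OF G \<phi>] *[OF H \<phi>] by (simp add: set_lebesgue_integral_def)
    moreover have "- (LINT x:\<Omega>|lebesgue. (G x \<bullet> i) * \<phi> x) = - (LINT x:\<Omega>|lebesgue. (H x \<bullet> i) * \<phi> x)"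
      using G H \<phi> i unfolding has_weak_gradient_def by metis
    ultimately show "(LINT x:\<Omega>|lebesgue. (G x \<bullet> i - H x \<bullet> i) * \<phi> x) = 0" by simp
  qed
  then show ?thesis by simp
qed

section \<open>Comparison with cones\<close>

text \<open>A smooth strict supersolution close to the cone \<open>L \<bar>y - z\<bar>\<close>. The cone itself has vanishing
  infinity-Laplacian but is not twice differentiable at \<open>z\<close>; \<open>\<epsilon>\<close> rounds off the vertex and costs a
  positive term concentrated near \<open>z\<close>, while subtracting \<open>\<kappa> \<bar>y - z\<bar>\<^sup>2\<close> makes the
  infinity-Laplacian negative away from \<open>z\<close>.\<close>

definition bent_cone :: "'a::euclidean_space \<Rightarrow> real \<Rightarrow> real \<Rightarrow> real \<Rightarrow> 'a \<Rightarrow> real" where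
  "bent_cone z L \<epsilon> \<kappa> y = L * (sqrt (\<epsilon> + (y - z) \<bullet> (y - z)) - \<kappa> * ((y - z) \<bullet> (y - z)))"

context
  fixes z :: "'a::euclidean_space" and L \<epsilon> \<kappa> :: real
  assumes eps: "0 < \<epsilon>"
begin

private abbreviation (input) s where "s y \<equiv> sqrt (\<epsilon> + (y - z) \<bullet> (y - z))"
private abbreviation (input) c where "c y \<equiv> L * (1 / s y - 2 * \<kappa>)"

lemma bent_cone_radius_pos: "0 < \<epsilon> + (y - z) \<bullet> (y - z)"
  using eps by (intro add_pos_nonneg) auto

lemma has_derivative_radius:
  "((\<lambda>y. s y) has_derivative (\<lambda>v. (v \<bullet> (y - z)) / s y)) (at y)"
proof -
  have pos: "0 < \<epsilon> + (y - z) \<bullet> (y - z)" by (rule bent_cone_radius_pos)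
  have "((\<lambda>y. \<epsilon> + (y - z) \<bullet> (y - z)) has_derivative (\<lambda>v. 2 * (v \<bullet> (y - z)))) (at y)"
    by (auto intro!: derivative_eq_intros simp: inner_commute)
  from DERIV_compose_FDERIV[OF DERIV_real_sqrt[OF pos] this]
  show ?thesis by (simp add: field_simps)
qed

lemma bent_cone_has_derivative:
  "(bent_cone z L \<epsilon> \<kappa> has_derivative (\<lambda>v. c y * (v \<bullet> (y - z)))) (at y)"
proof -
  have "((\<lambda>y. (y - z) \<bullet> (y - z)) has_derivative (\<lambda>v. 2 * (v \<bullet> (y - z)))) (at y)"
    by (auto intro!: derivative_eq_intros simp: inner_commute)
  then have "(bent_cone z L \<epsilon> \<kappa> has_derivative
      (\<lambda>v. L * ((v \<bullet> (y - z)) / s y - \<kappa> * (2 * (v \<bullet> (y - z)))))) (at y)"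
    unfolding bent_cone_def[abs_def]
    by (intro has_derivative_mult_right has_derivative_diff has_derivative_radius)
  moreover have "L * (a / r - \<kappa> * (2 * a)) = L * (1 / r - 2 * \<kappa>) * a" for a r
    by (simp add: algebra_simps)
  ultimately show ?thesis by simp
qed

lemma partial_deriv_bent_cone:
  "partial_deriv i (bent_cone z L \<epsilon> \<kappa>) = (\<lambda>y. c y * (i \<bullet> (y - z)))"
  using bent_cone_has_derivative by (auto intro!: partial_deriv_eqI)

lemma bent_cone_second_derivative:
  "((\<lambda>y. c y * (i \<bullet> (y - z))) has_derivative
     (\<lambda>v. c y * (i \<bullet> v) - L * (v \<bullet> (y - z)) * (i \<bullet> (y - z)) / s y ^ 3)) (at y)"
proof -
  have pos: "s y \<noteq> 0" using bent_cone_radius_pos[of y] by simp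
  have quot: "- (a / r) / r\<^sup>2 = - a / r ^ 3" for a r :: real
    by (simp add: power2_eq_square power3_eq_cube mult.assoc)
  have "((\<lambda>y. 1 / s y) has_derivative (\<lambda>v. - ((v \<bullet> (y - z)) / s y) / (s y)\<^sup>2)) (at y)"
    using has_derivative_divide[OF has_derivative_const[of 1] has_derivative_radius[of y] pos]
    by (simp add: power2_eq_square field_simps)
  then have "((\<lambda>y. 1 / s y) has_derivative (\<lambda>v. - (v \<bullet> (y - z)) / s y ^ 3)) (at y)"
    unfolding quot .
  from has_derivative_mult_right[OF has_derivative_diff[OF this has_derivative_const], of L "2 * \<kappa>"]
  have "((\<lambda>y. c y) has_derivative (\<lambda>v. L * (- (v \<bullet> (y - z)) / s y ^ 3))) (at y)"
    by simp
  moreover have "((\<lambda>y. i \<bullet> (y - z)) has_derivative (\<lambda>v. i \<bullet> v)) (at y)"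
    by (auto intro!: derivative_eq_intros)
  ultimately have "((\<lambda>y. c y * (i \<bullet> (y - z))) has_derivative
      (\<lambda>v. c y * (i \<bullet> v) + L * (- (v \<bullet> (y - z)) / s y ^ 3) * (i \<bullet> (y - z)))) (at y)"
    by (rule has_derivative_mult)
  moreover have "C * b + L * (- a / r) * d = C * b - L * a * d / r" for C b a r d
    by simp
  ultimately show ?thesis by simp
qed

lemma partial_deriv_bent_cone_2:
  "partial_deriv j (partial_deriv i (bent_cone z L \<epsilon> \<kappa>))
     = (\<lambda>y. c y * (i \<bullet> j) - L * (j \<bullet> (y - z)) * (i \<bullet> (y - z)) / s y ^ 3)"
  unfolding partial_deriv_bent_cone
  using bent_cone_second_derivative by (auto intro!: partial_deriv_eqI)

lemma C_2_bent_cone: "C_k 2 S (bent_cone z L \<epsilon> \<kappa>)"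
proof -
  have nz: "sqrt (\<epsilon> + (y - z) \<bullet> (y - z)) \<noteq> 0" for y using bent_cone_radius_pos[of y] by simp
  have "continuous_on S (partial_deriv j (partial_deriv i (bent_cone z L \<epsilon> \<kappa>)))" for i j
    unfolding partial_deriv_bent_cone_2 using nz by (auto intro!: continuous_intros)
  moreover have "partial_deriv i (bent_cone z L \<epsilon> \<kappa>) differentiable (at y)" for i y
    unfolding partial_deriv_bent_cone using bent_cone_second_derivative unfolding differentiable_def by blast
  moreover have "bent_cone z L \<epsilon> \<kappa> differentiable (at y)" for y
    using bent_cone_has_derivative unfolding differentiable_def by blast
  ultimately show ?thesis by (simp add: numeral_2_eq_2)
qed

lemma infinity_Laplacian_bent_cone:
  "infinity_Laplacian (bent_cone z L \<epsilon> \<kappa>) y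
     = (c y)\<^sup>2 * ((y - z) \<bullet> (y - z)) * (L * (\<epsilon> / s y ^ 3 - 2 * \<kappa>))"
proof -
  define w where "w = y - z"
  define \<rho> where "\<rho> = sqrt (\<epsilon> + w \<bullet> w)"
  define k where "k = L * (1 / \<rho> - 2 * \<kappa>)"
  have \<rho>: "\<rho> > 0" "\<rho>\<^sup>2 = \<epsilon> + w \<bullet> w"
    using bent_cone_radius_pos[of y] by (auto simp: \<rho>_def w_def)
  have ww: "(\<Sum>i\<in>Basis. (i \<bullet> w)\<^sup>2) = w \<bullet> w"
    by (subst euclidean_inner) (simp add: power2_eq_square inner_commute)
  have "infinity_Laplacian (bent_cone z L \<epsilon> \<kappa>) y
      = (\<Sum>i\<in>Basis. \<Sum>j\<in>Basis. (k * (i \<bullet> w)) * (k * (j \<bullet> w)) * (k * (i \<bullet> j) - L * (j \<bullet> w) * (i \<bullet> w) / \<rho> ^ 3))"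
    unfolding infinity_Laplacian_def partial_deriv_bent_cone_2
    unfolding partial_deriv_bent_cone k_def \<rho>_def w_def ..
  also have "\<dots> = (\<Sum>i\<in>Basis. \<Sum>j\<in>Basis. (if i = j then k ^ 3 * (i \<bullet> w)\<^sup>2 else 0) - k\<^sup>2 * L / \<rho> ^ 3 * ((i \<bullet> w)\<^sup>2 * (j \<bullet> w)\<^sup>2))"
    by (intro sum.cong refl) (auto simp: inner_Basis algebra_simps power2_eq_square power3_eq_cube)
  also have "\<dots> = k ^ 3 * (w \<bullet> w) - k\<^sup>2 * L / \<rho> ^ 3 * ((w \<bullet> w) * (w \<bullet> w))"
  proof -
    have "(\<Sum>i\<in>(Basis::'a set). \<Sum>j\<in>Basis. C * ((i \<bullet> w)\<^sup>2 * (j \<bullet> w)\<^sup>2)) = C * ((w \<bullet> w) * (w \<bullet> w))" for C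
      unfolding ww[symmetric] sum_product by (simp add: sum_distrib_left)
    moreover have "(\<Sum>i\<in>(Basis::'a set). \<Sum>j\<in>Basis. if i = j then k ^ 3 * (i \<bullet> w)\<^sup>2 else 0) = k ^ 3 * (w \<bullet> w)"
      by (simp add: sum_distrib_left[symmetric] ww)
    ultimately show ?thesis by (simp only: sum_subtractf)
  qed
  also have "\<dots> = k\<^sup>2 * (w \<bullet> w) * (k - L * (w \<bullet> w) / \<rho> ^ 3)"
    by (simp add: algebra_simps power2_eq_square power3_eq_cube)
  also have "k - L * (w \<bullet> w) / \<rho> ^ 3 = L * (1 / \<rho> - (w \<bullet> w) / \<rho> ^ 3 - 2 * \<kappa>)"
    unfolding k_def by (simp add: algebra_simps)
  also have "1 / \<rho> - (w \<bullet> w) / \<rho> ^ 3 = \<epsilon> / \<rho> ^ 3"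
  proof -
    have "1 / \<rho> = \<rho>\<^sup>2 / \<rho> ^ 3" using \<rho>(1) by (simp add: power2_eq_square power3_eq_cube)
    then show ?thesis by (simp add: \<rho>(2) flip: diff_divide_distrib)
  qed
  finally show ?thesis by (simp add: k_def \<rho>_def w_def)
qed

end

text \<open>Comparison with cones from above, up to the factor 2 that pays for bending the cone. Consider a
  maximum point \<open>y0\<close> of \<open>u\<close> minus the bent cone of slope \<open>L = 2 S / R\<close>. On the boundary sphere the
  bent cone exceeds \<open>S\<close>; close to \<open>x\<close> continuity of \<open>u\<close> suffices; anywhere else \<open>y0\<close> would be a point
  where a function with negative infinity-Laplacian touches \<open>u\<close> from above.\<close>

lemma infinity_harmonic_cone_bound_pos:
  fixes u :: "'a::euclidean_space \<Rightarrow> real"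
  assumes "open \<Omega>" and u: "infinity_harmonic \<Omega> u"
    and R: "0 < R" "cball x R \<subseteq> \<Omega>" and S: "0 < S" "\<And>y. y \<in> cball x R \<Longrightarrow> u y - u x \<le> S"
    and y: "y \<in> cball x R"
  shows "u y - u x \<le> (2 * S / R) * dist x y"
proof -
  define L where "L = 2 * S / R"
  have L: "L > 0" using R S by (simp add: L_def)
  have cont: "continuous_on \<Omega> u" using u by (simp add: infinity_harmonic_def)
  have main: "u y - u x \<le> L * dist x y + (1 + L) * \<eta>" if \<eta>: "0 < \<eta>" for \<eta>
  proof -
    have "x \<in> \<Omega>" using R by auto
    then have "isCont u x" using cont \<open>open \<Omega>\<close> continuous_on_eq_continuous_at by blast
    then obtain \<delta> where \<delta>: "\<delta> > 0" "\<And>y. dist y x < \<delta> \<Longrightarrow> dist (u y) (u x) < \<eta>"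
      unfolding continuous_at_eps_delta using \<eta> by blast
    \<comment> \<open>Bending by this amount loses at most a quarter of the height \<open>L * dist x y\<close> within the ball.\<close>
    define \<kappa> where "\<kappa> = 1 / (4 * R)"
    have \<kappa>: "\<kappa> > 0" using R by (simp add: \<kappa>_def)
    \<comment> \<open>The three bounds serve, in this order, the nonvanishing of the gradient inside the ball, the
      sign of the infinity-Laplacian at distance at least \<open>\<delta>\<close> from \<open>x\<close>, and the limit \<open>\<eta> \<rightarrow> 0\<close>.\<close>
    define \<epsilon> where "\<epsilon> = min (R\<^sup>2) (min (\<kappa> * \<delta> ^ 3) (\<eta>\<^sup>2))"
    have \<epsilon>: "0 < \<epsilon>" "\<epsilon> \<le> R\<^sup>2" "\<epsilon> \<le> \<kappa> * \<delta> ^ 3" "\<epsilon> \<le> \<eta>\<^sup>2"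
      using R \<kappa> \<delta> \<eta> by (auto simp: \<epsilon>_def)
    define \<phi> where "\<phi> = bent_cone x L \<epsilon> \<kappa>"
    have \<phi>: "\<phi> y = L * (sqrt (\<epsilon> + (dist x y)\<^sup>2) - \<kappa> * (dist x y)\<^sup>2)" for y
      by (simp add: \<phi>_def bent_cone_def dist_norm dot_square_norm norm_minus_commute)
    have \<phi>_ge: "\<phi> y \<ge> L * (3 / 4 * dist x y)" if "dist x y \<le> R" for y
    proof -
      have "dist x y \<le> sqrt (\<epsilon> + (dist x y)\<^sup>2)" using \<epsilon>(1) by (intro real_le_rsqrt) simp
      moreover have "\<kappa> * (dist x y)\<^sup>2 \<le> dist x y / 4"
      proof -
        have "dist x y * dist x y \<le> R * dist x y" by (rule mult_right_mono[OF that]) simp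
        then show ?thesis using R by (simp add: \<kappa>_def power2_eq_square field_simps)
      qed
      ultimately have "3 / 4 * dist x y \<le> sqrt (\<epsilon> + (dist x y)\<^sup>2) - \<kappa> * (dist x y)\<^sup>2" by linarith
      then show ?thesis unfolding \<phi> using L by (intro mult_left_mono) auto
    qed
    have \<phi>_C2: "C_k 2 \<Omega> \<phi>" unfolding \<phi>_def using \<epsilon>(1) by (rule C_2_bent_cone)
    have \<phi>_cont: "continuous_on (cball x R) \<phi>" unfolding \<phi>[abs_def] by (intro continuous_intros)
    obtain y0 where y0: "y0 \<in> cball x R" and max: "\<And>y. y \<in> cball x R \<Longrightarrow> u y - \<phi> y \<le> u y0 - \<phi> y0"
      using continuous_attains_sup[OF compact_cball[of x R], of "\<lambda>y. u y - \<phi> y"]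
        continuous_on_diff[OF continuous_on_subset[OF cont R(2)] \<phi>_cont] R(1) by auto
    have "u y0 - \<phi> y0 \<le> u x + \<eta>"
    proof -
      consider "dist x y0 < \<delta>" | "dist x y0 = R" | "\<delta> \<le> dist x y0" "dist x y0 < R"
        using y0 by fastforce
      then show ?thesis
      proof cases
        case 1
        then have "u y0 \<le> u x + \<eta>" using \<delta>(2)[of y0] by (simp add: dist_commute dist_real_def abs_less_iff)
        moreover have "0 \<le> L * (3 / 4 * dist x y0)" using L by simp
        ultimately show ?thesis using \<phi>_ge[of y0] y0 by simp
      next
        case 2
        have "L * (3 / 4 * R) = 3 / 2 * S" using R by (simp add: L_def)
        then show ?thesis using \<phi>_ge[of y0] S(2)[OF y0] S(1) \<eta> 2 by simp
      next
        case 3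
        have "y0 \<in> \<Omega>" using y0 R by blast
        moreover have "\<forall>\<^sub>F y in nhds y0. u y - \<phi> y \<le> u y0 - \<phi> y0"
          unfolding eventually_nhds
          by (rule exI[of _ "ball x R"]) (use 3 max in auto)
        ultimately have "- infinity_Laplacian \<phi> y0 \<le> 0"
          using u \<phi>_C2 unfolding infinity_harmonic_def by blast
        moreover have "infinity_Laplacian \<phi> y0 < 0"
        proof -
          define \<rho> where "\<rho> = sqrt (\<epsilon> + (y0 - x) \<bullet> (y0 - x))"
          have dd: "(y0 - x) \<bullet> (y0 - x) = (dist x y0)\<^sup>2"
            by (simp add: dist_norm dot_square_norm norm_minus_commute)
          have d\<rho>: "dist x y0 \<le> \<rho>" unfolding \<rho>_def dd using \<epsilon>(1) by (intro real_le_rsqrt) simp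
          have \<rho>_pos: "0 < \<rho>" using d\<rho> 3 \<delta> by linarith
          have "\<epsilon> + (dist x y0)\<^sup>2 < (2 * R)\<^sup>2"
          proof -
            have "(dist x y0)\<^sup>2 \<le> R\<^sup>2" using 3 by (intro power_mono) auto
            moreover have "0 < R\<^sup>2" using R(1) by (rule zero_less_power)
            moreover have "(2 * R)\<^sup>2 = 4 * R\<^sup>2" by (simp add: power_mult_distrib)
            ultimately show ?thesis using \<epsilon>(2) by linarith
          qed
          then have "\<rho> < 2 * R" unfolding \<rho>_def dd using R by (intro real_less_lsqrt) auto
          then have k: "1 / \<rho> - 2 * \<kappa> > 0" using \<rho>_pos R by (simp add: \<kappa>_def field_simps)
          have "\<epsilon> / \<rho> ^ 3 - 2 * \<kappa> < 0"
          proof -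
            have "\<delta> ^ 3 \<le> \<rho> ^ 3" using 3 d\<rho> \<delta> by (intro power_mono) auto
            then have "\<kappa> * \<delta> ^ 3 \<le> \<kappa> * \<rho> ^ 3" using \<kappa> by simp
            moreover have "0 < \<kappa> * \<rho> ^ 3" using \<kappa> \<rho>_pos by simp
            ultimately have "\<epsilon> < 2 * \<kappa> * \<rho> ^ 3" using \<epsilon>(3) by linarith
            then show ?thesis using \<rho>_pos by (simp add: divide_less_eq)
          qed
          moreover have "0 < (y0 - x) \<bullet> (y0 - x)" 
          proof -
            have "0 < dist x y0" using 3(1) \<delta>(1) by linarith
            then show ?thesis unfolding dd by (rule zero_less_power)
          qed
          moreover have "0 < (L * (1 / \<rho> - 2 * \<kappa>))\<^sup>2" using k L by simp
          ultimately show ?thesis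
            unfolding \<phi>_def infinity_Laplacian_bent_cone[OF \<epsilon>(1)] \<rho>_def[symmetric] using L
            by (intro mult_pos_neg mult_pos_pos)
        qed
        ultimately show ?thesis by simp
      qed
    qed
    then have "u y \<le> u x + \<eta> + \<phi> y" using max[OF y] by linarith
    moreover have "\<phi> y \<le> L * (dist x y + \<eta>)"
    proof -
      have "sqrt (\<epsilon> + (dist x y)\<^sup>2) \<le> sqrt \<epsilon> + sqrt ((dist x y)\<^sup>2)"
        using \<epsilon>(1) by (intro sqrt_add_le_add_sqrt) auto
      also have "sqrt \<epsilon> \<le> \<eta>" using \<epsilon>(4) \<eta> by (intro real_le_lsqrt) auto
      finally have "sqrt (\<epsilon> + (dist x y)\<^sup>2) \<le> \<eta> + dist x y" by simp
      moreover have "0 \<le> \<kappa> * (dist x y)\<^sup>2" using \<kappa> by simp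
      ultimately have "sqrt (\<epsilon> + (dist x y)\<^sup>2) - \<kappa> * (dist x y)\<^sup>2 \<le> dist x y + \<eta>" by linarith
      then show ?thesis unfolding \<phi> using L by (intro mult_left_mono) auto
    qed
    ultimately show ?thesis by (simp add: algebra_simps)
  qed
  have "u y - u x \<le> L * dist x y"
  proof (rule field_le_epsilon)
    fix e :: real assume "0 < e"
    then show "u y - u x \<le> L * dist x y + e" using main[of "e / (1 + L)"] L by simp
  qed
  then show ?thesis by (simp add: L_def)
qed

lemma infinity_harmonic_cone_bound:
  fixes u :: "'a::euclidean_space \<Rightarrow> real"
  assumes "open \<Omega>" and u: "infinity_harmonic \<Omega> u"
    and R: "0 < R" "cball x R \<subseteq> \<Omega>" and S: "0 \<le> S" "\<And>y. y \<in> cball x R \<Longrightarrow> u y - u x \<le> S"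
    and y: "y \<in> cball x R"
  shows "u y - u x \<le> (2 * S / R) * dist x y"
proof (cases "x = y")
  case False
  show ?thesis
  proof (rule field_le_epsilon)
    fix e :: real assume e: "0 < e"
    define t where "t = e * R / (2 * dist x y)"
    have t: "t > 0" using e R False by (simp add: t_def)
    have "u y - u x \<le> (2 * (S + t) / R) * dist x y"
      by (rule infinity_harmonic_cone_bound_pos[OF assms(1) u R _ _ y]) (use S t in force)+
    also have "\<dots> = (2 * S / R) * dist x y + e"
      using R False by (simp add: t_def field_simps)
    finally show "u y - u x \<le> (2 * S / R) * dist x y + e" .
  qed
qed simp

text \<open>The one-sided cone bound with vertex \<open>x\<close> controls \<open>u y - u x\<close>; the same bound with vertex \<open>y\<close>, in
  a ball of radius \<open>R / 2\<close>, controls \<open>u x - u y\<close>.\<close>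

lemma infinity_harmonic_Lipschitz_bound:
  fixes u :: "'a::euclidean_space \<Rightarrow> real"
  assumes "open \<Omega>" and u: "infinity_harmonic \<Omega> u"
    and R: "0 < R" "cball x R \<subseteq> \<Omega>" and B: "\<And>y. y \<in> cball x R \<Longrightarrow> \<bar>u y - a\<bar> \<le> B"
    and y: "y \<in> cball x (R / 2)"
  shows "\<bar>u y - u x\<bar> \<le> (8 * B / R) * dist x y"
proof -
  have B0: "0 \<le> B" using B[of x] R by simp
  have osc: "u y - u z \<le> 2 * B" if "y \<in> cball x R" "z \<in> cball x R" for y z
    using B[OF that(1)] B[OF that(2)] by linarith
  have "u y - u x \<le> (2 * (2 * B) / R) * dist x y"
    by (rule infinity_harmonic_cone_bound[OF assms(1,2) R]) (use osc y R B0 in auto)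
  also have "\<dots> \<le> (8 * B / R) * dist x y"
    using B0 R by (intro mult_right_mono divide_right_mono) auto
  finally have 1: "u y - u x \<le> (8 * B / R) * dist x y" .
  have sub: "cball y (R / 2) \<subseteq> cball x R"
  proof
    fix w assume "w \<in> cball y (R / 2)"
    then show "w \<in> cball x R" using y dist_triangle[of x w y] by simp
  qed
  have "u x - u y \<le> (2 * (2 * B) / (R / 2)) * dist y x"
  proof (rule infinity_harmonic_cone_bound[OF assms(1,2)])
    show "cball y (R / 2) \<subseteq> \<Omega>" using sub R by blast
    have "y \<in> cball x R" using y R by auto
    then show "u w - u y \<le> 2 * B" if "w \<in> cball y (R / 2)" for w
      using osc sub that by blast
  qed (use R B0 y in \<open>auto simp: dist_commute\<close>)
  then have 2: "u x - u y \<le> (8 * B / R) * dist x y" by (simp add: dist_commute)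
  from 1 2 show ?thesis by linarith
qed

lemma infinity_harmonic_imp_locally_Lipschitz:
  fixes u :: "'a::euclidean_space \<Rightarrow> real"
  assumes "open \<Omega>" and u: "infinity_harmonic \<Omega> u"
  shows "locally_Lipschitz \<Omega> u"
  unfolding locally_Lipschitz_def
proof (intro allI impI, elim conjE)
  fix K assume K: "compact K" "K \<subseteq> \<Omega>"
  have cont: "continuous_on \<Omega> u" using u by (simp add: infinity_harmonic_def)
  obtain r where r: "r > 0" "(\<Union>x\<in>K. cball x r) \<subseteq> \<Omega>"
    using compact_subset_open_imp_cball_epsilon_subset[OF K(1) \<open>open \<Omega>\<close> K(2)] by blast
  define K' where "K' = {x + y | x y. x \<in> K \<and> y \<in> cball 0 r}"
  have K': "compact K'" unfolding K'_def by (intro compact_sums K compact_cball)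
  have inK': "y \<in> K'" if "x \<in> K" "y \<in> cball x r" for x y
    unfolding K'_def mem_Collect_eq
    by (rule exI[of _ x], rule exI[of _ "y - x"]) (use that in \<open>auto simp: dist_norm norm_minus_commute\<close>)
  have "K' \<subseteq> \<Omega>" using r(2) unfolding K'_def by (force simp: dist_norm)
  then have "bounded (u ` K')"
    by (intro compact_imp_bounded compact_continuous_image K' continuous_on_subset[OF cont])
  then obtain B where B: "\<And>x. x \<in> K' \<Longrightarrow> \<bar>u x - 0\<bar> \<le> B" unfolding bounded_iff by auto
  show "\<exists>r>0. \<exists>L. \<forall>x\<in>K. cball x r \<subseteq> \<Omega> \<and> (\<forall>y\<in>cball x r. \<bar>u y - u x\<bar> \<le> L * dist x y)"
  proof (rule exI[of _ "r / 2"], rule conjI, use r(1) in simp, rule exI[of _ "8 * B / r"], intro ballI conjI)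
    fix x assume x: "x \<in> K"
    have sub: "cball x r \<subseteq> \<Omega>" using r(2) x by blast
    then show "cball x (r / 2) \<subseteq> \<Omega>" using r(1) by (auto simp: subset_iff)
    fix y assume "y \<in> cball x (r / 2)"
    then show "\<bar>u y - u x\<bar> \<le> (8 * B / r) * dist x y"
      using infinity_harmonic_Lipschitz_bound[OF assms r(1) sub, of 0 B y] B inK'[OF x] by blast
  qed
qed

section \<open>The local maximum principle\<close>

lemma powr_le_imp_le_base:
  fixes x y p :: real
  assumes "0 < p" "0 \<le> y" "x powr p \<le> y powr p"
  shows "x \<le> y"
  using powr_less_mono2[OF assms(1,2), of x] assms(3) by linarith

text \<open>Let \<open>y0\<close> maximise \<open>(R - dist x z)\<^sup>n \<bar>u z - a\<bar>\<^sup>p\<close> over the ball, let \<open>M\<close> be the value of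
  \<open>\<bar>u - a\<bar>\<close> there and \<open>s\<close> half the distance of \<open>y0\<close> to the sphere. The factor
  \<open>R - dist x z\<close> is at least half its value at \<open>y0\<close> on the ball of radius \<open>s\<close> about \<open>y0\<close>, so
  \<open>\<bar>u - a\<bar> \<le> \<theta> M\<close> there, and the Lipschitz bound keeps \<open>\<bar>u - a\<bar> \<ge> M / 2\<close> on a concentric ball of radius proportional to \<open>s\<close>. Hence the integral
  dominates \<open>s\<^sup>n M\<^sup>p\<close>, which in turn dominates the weighted values in the half ball.\<close>

lemma local_maximum_principle:
  fixes u :: "'a::euclidean_space \<Rightarrow> real" and p :: real
  assumes "open \<Omega>" and u: "infinity_harmonic \<Omega> u" and p: "0 < p"
    and R: "0 < R" "cball x R \<subseteq> \<Omega>"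
    and I: "(\<integral>\<^sup>+z. indicator (cball x R) z * ennreal (\<bar>u z - a\<bar> powr p) \<partial>lborel) \<le> ennreal I" "0 \<le> I"
    and y: "y \<in> cball x (R / 2)"
  defines "n \<equiv> DIM('a)"
  defines "\<theta> \<equiv> 2 powr (real n / p)"
  shows "\<bar>u y - a\<bar> powr p * R ^ n \<le> 64 ^ n * \<theta> ^ n * 2 powr p / unit_ball_vol (real n) * I"
proof -
  have cont: "continuous_on (cball x R) u"
    using u R by (auto simp: infinity_harmonic_def intro: continuous_on_subset)
  have \<theta>: "\<theta> \<ge> 1" "\<theta> powr p = 2 ^ n"
    using p by (auto simp: \<theta>_def ge_one_powr_ge_zero powr_powr powr_realpow)
  have vol: "unit_ball_vol (real n) > 0" by simp
  define W where "W z = (R - dist x z) ^ n * \<bar>u z - a\<bar> powr p" for z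
  have "continuous_on (cball x R) W"
    unfolding W_def using p cont by (auto intro!: continuous_intros continuous_on_powr')
  then obtain y0 where y0: "y0 \<in> cball x R" and max: "\<And>z. z \<in> cball x R \<Longrightarrow> W z \<le> W y0"
    using continuous_attains_sup[OF compact_cball[of x R], of W] R(1) by auto
  define M where "M = \<bar>u y0 - a\<bar>"
  define s where "s = (R - dist x y0) / 2"
  have s0: "0 \<le> s" using y0 by (simp add: s_def)
  have W0: "W y0 = (2 * s) ^ n * M powr p"
  proof -
    have "R - dist x y0 = 2 * s" by (simp add: s_def)
    then show ?thesis by (simp add: W_def M_def)
  qed
  have Wy: "(R / 2) ^ n * \<bar>u y - a\<bar> powr p \<le> W y0"
  proof -
    have "(R / 2) ^ n * \<bar>u y - a\<bar> powr p \<le> W y"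
      unfolding W_def using y R by (intro mult_right_mono power_mono) auto
    also have "\<dots> \<le> W y0" using y R by (intro max) auto
    finally show ?thesis .
  qed
  have yW: "\<bar>u y - a\<bar> powr p * R ^ n \<le> 4 ^ n * (s ^ n * M powr p)"
  proof -
    have "\<bar>u y - a\<bar> powr p * R ^ n = 2 ^ n * ((R / 2) ^ n * \<bar>u y - a\<bar> powr p)"
      by (simp add: power_divide)
    also have "\<dots> \<le> 2 ^ n * W y0" using Wy by simp
    also have "\<dots> = (2 * 2) ^ n * (s ^ n * M powr p)" by (simp only: W0 power_mult_distrib mult.assoc)
    finally show ?thesis by simp
  qed
  have main: "4 ^ n * (s ^ n * M powr p) \<le> 64 ^ n * \<theta> ^ n * 2 powr p / unit_ball_vol (real n) * I"
  proof (cases "s = 0 \<or> M = 0")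
    case True
    then have "s ^ n * M powr p = 0" by (auto simp: n_def)
    then have "4 ^ n * (s ^ n * M powr p) = 0" by (simp only: mult_zero_right)
    moreover have "0 \<le> 64 ^ n * \<theta> ^ n * 2 powr p / unit_ball_vol (real n) * I"
      using I(2) vol \<theta>(1) by (intro mult_nonneg_nonneg divide_nonneg_nonneg) auto
    ultimately show ?thesis by (simp only:)
  next
    case False
    then have s: "0 < s" and M: "0 < M" using s0 by (auto simp: M_def)
    have dist_le: "s \<le> R - dist x z" if "z \<in> cball y0 s" for z
      using that dist_triangle[of x z y0] by (simp add: s_def)
    have sub: "cball y0 s \<subseteq> cball x R"
    proof
      fix z assume "z \<in> cball y0 s"
      from dist_le[OF this] s show "z \<in> cball x R" by simp
    qed
    have bound: "\<bar>u z - a\<bar> \<le> \<theta> * M" if z: "z \<in> cball y0 s" for z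
    proof -
      have "s ^ n * \<bar>u z - a\<bar> powr p \<le> W z"
        unfolding W_def using dist_le[OF z] s by (intro mult_right_mono power_mono) auto
      also have "\<dots> \<le> W y0" using sub z by (intro max) blast
      also have "\<dots> = s ^ n * (\<theta> * M) powr p"
        using \<theta> M by (simp add: W0 powr_mult power_mult_distrib)
      finally have "\<bar>u z - a\<bar> powr p \<le> (\<theta> * M) powr p" using s by simp
      then show ?thesis by (rule powr_le_imp_le_base[OF p, rotated]) (use \<theta>(1) M in simp)
    qed
    \<comment> \<open>The radius at which the Lipschitz constant \<open>8 \<theta> M / s\<close> allows a change of \<open>M / 2\<close>.\<close>
    define \<sigma> where "\<sigma> = s / (16 * \<theta>)"
    have \<sigma>: "0 < \<sigma>" "\<sigma> \<le> s / 2" using s \<theta>(1) by (auto simp: \<sigma>_def field_simps)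
    have large: "M / 2 \<le> \<bar>u z - a\<bar>" if z: "z \<in> cball y0 \<sigma>" for z
    proof -
      have "\<bar>u z - u y0\<bar> \<le> (8 * (\<theta> * M) / s) * dist y0 z"
        by (rule infinity_harmonic_Lipschitz_bound[OF assms(1) u s _ bound])
           (use sub R(2) z \<sigma> s in auto)
      also have "\<dots> \<le> (8 * (\<theta> * M) / s) * \<sigma>"
        using z s M \<theta>(1) by (intro mult_left_mono) auto
      also have "\<dots> = M / 2" using s \<theta>(1) by (simp add: \<sigma>_def)
      finally have "\<bar>u z - u y0\<bar> \<le> M / 2" .
      moreover have "M \<le> \<bar>u z - a\<bar> + \<bar>u z - u y0\<bar>"
        using abs_triangle_ineq[of "u z - a" "u y0 - u z"] by (simp add: M_def abs_minus_commute)
      ultimately show ?thesis by linarith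
    qed
    have "ennreal ((M / 2) powr p * (unit_ball_vol (real n) * \<sigma> ^ n))
        = ennreal ((M / 2) powr p) * emeasure lborel (cball y0 \<sigma>)"
      using \<sigma>(1) by (simp add: emeasure_cball ennreal_mult n_def)
    also have "\<dots> = (\<integral>\<^sup>+z. ennreal ((M / 2) powr p) * indicator (cball y0 \<sigma>) z \<partial>lborel)"
      by (simp add: nn_integral_cmult_indicator)
    also have "\<dots> \<le> (\<integral>\<^sup>+z. indicator (cball x R) z * ennreal (\<bar>u z - a\<bar> powr p) \<partial>lborel)"
    proof (rule nn_integral_mono)
      fix z
      show "ennreal ((M / 2) powr p) * indicator (cball y0 \<sigma>) z
          \<le> indicator (cball x R) z * ennreal (\<bar>u z - a\<bar> powr p)"
      proof (cases "z \<in> cball y0 \<sigma>")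
        case True
        then have "z \<in> cball y0 s" using \<sigma> s by auto
        then have "z \<in> cball x R" using sub by blast
        moreover have "(M / 2) powr p \<le> \<bar>u z - a\<bar> powr p"
          using large[OF True] M p by (intro powr_mono2) auto
        ultimately show ?thesis using True by (simp add: ennreal_leI)
      qed simp
    qed
    also have "\<dots> \<le> ennreal I" by fact
    finally have low: "(M / 2) powr p * (unit_ball_vol (real n) * \<sigma> ^ n) \<le> I"
      using I(2) by (simp add: ennreal_le_iff)
    have "4 ^ n * (s ^ n * M powr p)
        = 64 ^ n * \<theta> ^ n * 2 powr p / unit_ball_vol (real n) * ((M / 2) powr p * (unit_ball_vol (real n) * \<sigma> ^ n))"
    proof -
      have "s ^ n = 16 ^ n * \<theta> ^ n * \<sigma> ^ n"
      proof -
        have "s = 16 * \<theta> * \<sigma>" using \<theta>(1) by (simp add: \<sigma>_def)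
        then show ?thesis by (simp only: power_mult_distrib)
      qed
      moreover have "M powr p = 2 powr p * (M / 2) powr p"
        using M powr_mult[of 2 "M / 2" p] by simp
      moreover have "(64::real) ^ n = 4 ^ n * 16 ^ n" using power_mult_distrib[of "4::real" 16 n] by simp
      ultimately show ?thesis by (simp add: mult_ac vol[THEN less_imp_neq, symmetric])
    qed
    also have "\<dots> \<le> 64 ^ n * \<theta> ^ n * 2 powr p / unit_ball_vol (real n) * I"
      using vol \<theta>(1) by (intro mult_left_mono low) auto
    finally show ?thesis .
  qed
  from yW main show ?thesis by (rule order_trans)
qed

section \<open>The gradient estimate\<close>

text \<open>The last factor is the constant of \<open>local_maximum_principle\<close>. The first one collects the
  Lipschitz constant \<open>8 B / (R / 2)\<close> of a function bounded by \<open>B\<close> on the half ball, and the passage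
  from the \<open>n\<close> components of the gradient to its norm.\<close>

definition gradient_const :: "nat \<Rightarrow> real \<Rightarrow> real" where
  "gradient_const n p = (16 * real n) powr p * (64 ^ n * (2 powr (real n / p)) ^ n * 2 powr p / unit_ball_vol (real n))"

lemma gradient_const_pos: "0 < n \<Longrightarrow> 0 < gradient_const n p"
  unfolding gradient_const_def by (intro mult_pos_pos divide_pos_pos) auto

text \<open>The vector \<open>G\<close> stands for the value at \<open>x\<close> of a weak gradient that inherits all Lipschitz bounds of
  \<open>u\<close> at \<open>x\<close>. The maximum principle bounds \<open>\<bar>u - a\<bar>\<close> on the half ball, and the Lipschitz bound then
  applies there.\<close>

lemma weak_gradient_pointwise_bound:
  fixes u :: "'a::euclidean_space \<Rightarrow> real" and G :: 'a
  assumes "open \<Omega>" and u: "infinity_harmonic \<Omega> u" and p: "0 < p"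
    and R: "0 < R" "cball x R \<subseteq> \<Omega>"
    and G: "\<And>r c i. 0 < r \<Longrightarrow> ball x r \<subseteq> \<Omega> \<Longrightarrow> (\<And>y. y \<in> ball x r \<Longrightarrow> \<bar>u y - u x\<bar> \<le> c * dist x y)
      \<Longrightarrow> i \<in> Basis \<Longrightarrow> \<bar>G \<bullet> i\<bar> \<le> c"
  shows "ennreal (norm G powr p) \<le> ennreal (gradient_const DIM('a) p / (R powr p * R ^ DIM('a)))
    * (\<integral>\<^sup>+z. indicator (cball x R) z * ennreal (\<bar>u z - a\<bar> powr p) \<partial>lborel)"
proof -
  define J where "J = (\<integral>\<^sup>+z. indicator (cball x R) z * ennreal (\<bar>u z - a\<bar> powr p) \<partial>lborel)"
  define n where "n = DIM('a)"
  have n: "0 < n" by (simp add: n_def)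
  define c where "c = gradient_const n p / (R powr p * R ^ n)"
  have c0: "0 < c"
    using gradient_const_pos[OF n, of p] R by (simp add: c_def)
  show ?thesis
  proof (cases "J = top")
    case True
    then show ?thesis using c0 unfolding J_def[symmetric] n_def[symmetric] c_def[symmetric]
      by (simp add: ennreal_mult_top)
  next
    case False
    define I where "I = enn2real J"
    have JI: "J = ennreal I" "0 \<le> I" using False by (auto simp: I_def top.not_eq_extremum)
    define K where "K = 64 ^ n * (2 powr (real n / p)) ^ n * 2 powr p / unit_ball_vol (real n)"
    have K: "0 \<le> K" by (simp add: K_def)
    define B where "B = (K * I / R ^ n) powr (1 / p)"
    have KI: "0 \<le> K * I / R ^ n" using K JI R by simp
    have "(q powr (1 / p)) powr p = q" if "0 \<le> q" for q :: real
      using that p by (simp add: powr_powr)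
    from this[OF KI] have Bp: "B powr p = K * I / R ^ n" by (simp only: B_def)
    have B0: "0 \<le> B" by (simp add: B_def)
    have bound: "\<bar>u y - a\<bar> \<le> B" if "y \<in> cball x (R / 2)" for y
    proof -
      have "\<bar>u y - a\<bar> powr p * R ^ n \<le> K * I"
        unfolding K_def n_def
        by (rule local_maximum_principle[OF assms(1) u p R _ _ that]) (use JI in \<open>auto simp: J_def\<close>)
      then have "\<bar>u y - a\<bar> powr p \<le> B powr p" using R by (simp add: Bp pos_le_divide_eq)
      then show ?thesis by (rule powr_le_imp_le_base[OF p B0])
    qed
    have comp: "\<bar>G \<bullet> i\<bar> \<le> 16 * B / R" if i: "i \<in> Basis" for i
    proof (rule G[of "R / 4"])
      show "0 < R / 4" "ball x (R / 4) \<subseteq> \<Omega>" using R by (auto simp: subset_iff)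
      show "i \<in> Basis" by fact
      fix y assume "y \<in> ball x (R / 4)"
      then have "y \<in> cball x (R / 2 / 2)" by simp
      moreover have "cball x (R / 2) \<subseteq> \<Omega>" using R by (auto simp: subset_iff)
      ultimately have "\<bar>u y - u x\<bar> \<le> (8 * B / (R / 2)) * dist x y"
        by (intro infinity_harmonic_Lipschitz_bound[OF assms(1) u _ _ bound]) (use R in auto)
      then show "\<bar>u y - u x\<bar> \<le> 16 * B / R * dist x y" by simp
    qed
    have "norm G \<le> (\<Sum>i\<in>Basis. \<bar>G \<bullet> i\<bar>)" by (rule norm_le_l1)
    also have "\<dots> \<le> (\<Sum>i\<in>(Basis::'a set). 16 * B / R)" by (intro sum_mono comp)
    also have "\<dots> = 16 * real n * B / R" by (simp add: n_def)
    finally have "norm G powr p \<le> (16 * real n * B / R) powr p" using p by (intro powr_mono2) auto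
    also have "\<dots> = (16 * real n) powr p * B powr p / R powr p"
      using R B0 by (simp add: powr_mult powr_divide)
    also have "\<dots> = c * I"
      unfolding Bp c_def gradient_const_def K_def[symmetric] by (simp add: mult_ac)
    finally have "ennreal (norm G powr p) \<le> ennreal (c * I)"
      by (rule ennreal_leI)
    also have "\<dots> = ennreal (c) * J"
      using c0 JI by (simp add: ennreal_mult less_imp_le)
    finally show ?thesis unfolding J_def n_def c_def .
  qed
qed

text \<open>Integrate the pointwise bound over \<open>V\<close> and exchange the order of integration: a point \<open>z\<close> of \<open>U\<close> is
  counted by the \<open>x\<close> in a ball of radius \<open>R\<close> about \<open>z\<close>, whose volume cancels the factor \<open>R\<^sup>-\<^sup>n\<close>.\<close>

lemma integral_gradient_bound:
  fixes u :: "'a::euclidean_space \<Rightarrow> real"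
  assumes "open \<Omega>" and u: "infinity_harmonic \<Omega> u" and p: "0 < p"
    and U: "open U" "U \<subseteq> \<Omega>" and R: "0 < R" and V: "\<And>x. x \<in> V \<Longrightarrow> cball x R \<subseteq> U"
  shows "(\<integral>\<^sup>+x\<in>V. ennreal (norm (weak_gradient \<Omega> u x) powr p) \<partial>lebesgue)
    \<le> ennreal (gradient_const DIM('a) p * unit_ball_vol (real DIM('a)) / R powr p)
      * (\<integral>\<^sup>+x\<in>U. ennreal (\<bar>u x - a\<bar> powr p) \<partial>lebesgue)"
proof -
  define n where "n = DIM('a)"
  define c where "c = gradient_const n p / (R powr p * R ^ n)"
  have c0: "0 < c" using gradient_const_pos[of n p] R by (simp add: c_def n_def)
  obtain G where G: "has_weak_gradient \<Omega> u G"
    and G_le: "\<And>x r c i. 0 < r \<Longrightarrow> ball x r \<subseteq> \<Omega> \<Longrightarrow> (\<And>y. y \<in> ball x r \<Longrightarrow> \<bar>u y - u x\<bar> \<le> c * dist x y)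
      \<Longrightarrow> i \<in> Basis \<Longrightarrow> \<bar>G x \<bullet> i\<bar> \<le> c"
    by (rule weak_gradient_exists[OF assms(1) infinity_harmonic_imp_locally_Lipschitz[OF assms(1) u]]) blast
  have W: "has_weak_gradient \<Omega> u (weak_gradient \<Omega> u)"
    unfolding weak_gradient_def by (rule someI[where P = "has_weak_gradient \<Omega> u", OF G])
  have "AE x in lebesgue. \<forall>i\<in>Basis. x \<in> \<Omega> \<longrightarrow> weak_gradient \<Omega> u x \<bullet> i = G x \<bullet> i"
    by (intro AE_finite_allI finite_Basis weak_gradient_unique[OF assms(1) W G])
  then have WG: "AE x in lebesgue. x \<in> \<Omega> \<longrightarrow> weak_gradient \<Omega> u x = G x"
    by eventually_elim (auto intro: euclidean_eqI)
  define F where "F z = indicator U z * ennreal (\<bar>u z - a\<bar> powr p)" for z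
  have F_meas[measurable]: "F \<in> borel_measurable borel"
  proof -
    have "continuous_on U u" using u U by (auto simp: infinity_harmonic_def intro: continuous_on_subset)
    then have "continuous_on U (\<lambda>z. \<bar>u z - a\<bar> powr p)"
      using p by (auto intro!: continuous_intros continuous_on_powr')
    then have "(\<lambda>z. indicator U z *\<^sub>R (\<bar>u z - a\<bar> powr p)) \<in> borel_measurable borel"
      using U(1) by (intro borel_measurable_continuous_on_indicator) auto
    then have "(\<lambda>z. ennreal (indicator U z *\<^sub>R (\<bar>u z - a\<bar> powr p))) \<in> borel_measurable borel"
      by measurable
    moreover have "(\<lambda>z. ennreal (indicator U z *\<^sub>R (\<bar>u z - a\<bar> powr p))) = F"
      by (auto simp: F_def fun_eq_iff indicator_def)
    ultimately show ?thesis by (simp only:)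
  qed
  have pw: "ennreal (norm (G x) powr p) * indicator V x
      \<le> ennreal c * (\<integral>\<^sup>+z. (if dist x z \<le> R then F z else 0) \<partial>lborel)" for x
  proof (cases "x \<in> V")
    case True
    then have sub: "cball x R \<subseteq> U" by (rule V)
    have "ennreal (norm (G x) powr p) \<le> ennreal c * (\<integral>\<^sup>+z. indicator (cball x R) z * ennreal (\<bar>u z - a\<bar> powr p) \<partial>lborel)"
      unfolding c_def n_def
      by (rule weak_gradient_pointwise_bound[OF assms(1) u p R _ G_le]) (use sub U in auto)
    also have "(\<integral>\<^sup>+z. indicator (cball x R) z * ennreal (\<bar>u z - a\<bar> powr p) \<partial>lborel)
        = (\<integral>\<^sup>+z. (if dist x z \<le> R then F z else 0) \<partial>lborel)"
      by (rule nn_integral_cong) (use sub in \<open>auto simp: F_def indicator_def\<close>)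
    finally show ?thesis using True by simp
  qed simp
  have "(\<integral>\<^sup>+x\<in>V. ennreal (norm (weak_gradient \<Omega> u x) powr p) \<partial>lebesgue)
      \<le> (\<integral>\<^sup>+x. ennreal c * (\<integral>\<^sup>+z. (if dist x z \<le> R then F z else 0) \<partial>lborel) \<partial>lebesgue)"
  proof (rule nn_integral_mono_AE)
    show "AE x in lebesgue. ennreal (norm (weak_gradient \<Omega> u x) powr p) * indicator V x
        \<le> ennreal c * (\<integral>\<^sup>+z. (if dist x z \<le> R then F z else 0) \<partial>lborel)"
      using WG
    proof eventually_elim
      case (elim x)
      have "weak_gradient \<Omega> u x = G x" if "x \<in> V"
      proof -
        have "x \<in> cball x R" using R by simp
        then show ?thesis using elim V[OF that] U(2) by blast
      qed
      then show ?case using pw[of x] by (cases "x \<in> V") auto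
    qed
  qed
  also have "\<dots> = (\<integral>\<^sup>+x. ennreal c * (\<integral>\<^sup>+z. (if dist x z \<le> R then F z else 0) \<partial>lborel) \<partial>lborel)"
    by (rule nn_integral_completion)
  also have "\<dots> = ennreal c * (\<integral>\<^sup>+x. (\<integral>\<^sup>+z. (if dist x z \<le> R then F z else 0) \<partial>lborel) \<partial>lborel)"
    by (rule nn_integral_cmult) measurable
  also have "(\<integral>\<^sup>+x. (\<integral>\<^sup>+z. (if dist x z \<le> R then F z else 0) \<partial>lborel) \<partial>lborel)
      = (\<integral>\<^sup>+z. (\<integral>\<^sup>+x. (if dist x z \<le> R then F z else 0) \<partial>lborel) \<partial>lborel)"
    by (rule lborel_pair.Fubini') measurable
  also have "\<dots> = (\<integral>\<^sup>+z. F z * ennreal (unit_ball_vol (real n) * R ^ n) \<partial>lborel)"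
  proof (rule nn_integral_cong)
    fix z
    have "(\<integral>\<^sup>+x. (if dist x z \<le> R then F z else 0) \<partial>lborel) = (\<integral>\<^sup>+x. F z * indicator (cball z R) x \<partial>lborel)"
      by (rule nn_integral_cong) (auto simp: indicator_def dist_commute)
    also have "\<dots> = F z * emeasure lborel (cball z R)" by (simp add: nn_integral_cmult_indicator)
    finally show "(\<integral>\<^sup>+x. (if dist x z \<le> R then F z else 0) \<partial>lborel) = F z * ennreal (unit_ball_vol (real n) * R ^ n)"
      using R by (simp add: emeasure_cball n_def)
  qed
  also have "\<dots> = (\<integral>\<^sup>+z. F z \<partial>lborel) * ennreal (unit_ball_vol (real n) * R ^ n)"
    by (rule nn_integral_multc) simp
  also have "(\<integral>\<^sup>+z. F z \<partial>lborel) = (\<integral>\<^sup>+x\<in>U. ennreal (\<bar>u x - a\<bar> powr p) \<partial>lebesgue)"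
    by (simp add: nn_integral_completion F_def mult.commute)
  also have "ennreal c * ((\<integral>\<^sup>+x\<in>U. ennreal (\<bar>u x - a\<bar> powr p) \<partial>lebesgue) * ennreal (unit_ball_vol (real n) * R ^ n))
      = ennreal (gradient_const n p * unit_ball_vol (real n) / R powr p) * (\<integral>\<^sup>+x\<in>U. ennreal (\<bar>u x - a\<bar> powr p) \<partial>lebesgue)"
  proof -
    have "ennreal c * ennreal (unit_ball_vol (real n) * R ^ n) = ennreal (c * (unit_ball_vol (real n) * R ^ n))"
      using c0 R by (simp add: ennreal_mult)
    also have "c * (unit_ball_vol (real n) * R ^ n) = gradient_const n p * unit_ball_vol (real n) / R powr p"
      using R by (simp add: c_def)
    finally have eq: "ennreal c * ennreal (unit_ball_vol (real n) * R ^ n)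
        = ennreal (gradient_const n p * unit_ball_vol (real n) / R powr p)" .
    show ?thesis unfolding eq[symmetric] by (simp only: mult_ac)
  qed
  finally show ?thesis unfolding n_def .
qed

lemma Lp_norm_le:
  assumes p: "0 < p" and k: "0 < k"
    and le: "(\<integral>\<^sup>+x\<in>A. ennreal (\<bar>f x\<bar> powr p) \<partial>lebesgue) \<le> ennreal (k powr p) * (\<integral>\<^sup>+x\<in>B. ennreal (\<bar>g x\<bar> powr p) \<partial>lebesgue)"
  shows "Lp_norm p A f \<le> ennreal k * Lp_norm p B g"
proof -
  define I where "I = (\<integral>\<^sup>+x\<in>A. ennreal (\<bar>f x\<bar> powr p) \<partial>lebesgue)"
  define J where "J = (\<integral>\<^sup>+x\<in>B. ennreal (\<bar>g x\<bar> powr p) \<partial>lebesgue)"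
  show ?thesis
  proof (cases "J = \<infinity>")
    case True
    then show ?thesis using k by (simp add: Lp_norm_def J_def[symmetric] ennreal_mult_top)
  next
    case False
    then obtain j where j: "J = ennreal j" "0 \<le> j" by (cases J) auto
    have "I \<le> ennreal (k powr p * j)" using le j by (simp add: I_def J_def ennreal_mult)
    then obtain i where i: "I = ennreal i" "0 \<le> i" "i \<le> k powr p * j"
      using j by (cases I) (auto simp: ennreal_le_iff top_unique)
    have "i powr (1 / p) \<le> (k powr p * j) powr (1 / p)" using i p by (intro powr_mono2) auto
    also have "\<dots> = k * j powr (1 / p)" using k j p by (simp add: powr_mult powr_powr)
    finally show ?thesis
      using i j k by (simp add: Lp_norm_def I_def[symmetric] J_def[symmetric] ennreal_leI flip: ennreal_mult)
  qed
qed

text \<open>A ball is connected, so one that meets \<open>U\<close> and its complement meets the frontier.\<close>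

lemma cball_subset_of_setdist_frontier:
  fixes U :: "'a::euclidean_space set"
  assumes "x \<in> V" "V \<subseteq> U" "r < setdist V (frontier U)" "0 \<le> r"
  shows "cball x r \<subseteq> U"
proof (rule ccontr)
  assume "\<not> cball x r \<subseteq> U"
  then have "cball x r \<inter> frontier U \<noteq> {}"
  proof (intro connected_Int_frontier)
    show "cball x r \<inter> U \<noteq> {}" using assms centre_in_cball[of x r] by blast
  qed auto
  then obtain f where f: "f \<in> frontier U" "dist x f \<le> r" by auto
  from setdist_le_dist[OF assms(1) f(1)] f(2) assms(3) show False by linarith
qed

lemma setdist_frontier_pos:
  fixes U :: "'a::euclidean_space set"
  assumes "V \<noteq> {}" "bounded U" "open U" "bounded V" "closure V \<subseteq> U"
  shows "0 < setdist V (frontier U)"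
proof -
  have "U \<noteq> {}" using assms closure_subset[of V] by blast
  moreover have "U \<noteq> UNIV" using assms(2) not_bounded_UNIV by metis
  ultimately have "frontier U \<noteq> {}" by (simp add: frontier_eq_empty)
  moreover have "closure V \<inter> frontier U = {}" using assms(3,5) by (auto simp: frontier_def interior_open)
  ultimately have "setdist (closure V) (frontier U) > 0"
    using assms by (subst setdist_gt_0_compact_closed) (auto simp: compact_closure)
  then show ?thesis by simp
qed

theorem theorem1p6:
  fixes p :: real
  assumes "p > 2"
  shows "\<exists>C::real. C > 0 \<and>
    (\<forall>(\<Omega> :: (real^2) set) (u :: real^2 \<Rightarrow> real).
       domain \<Omega> \<and> infinity_harmonic \<Omega> u \<longrightarrow>
       (\<forall>(V :: (real^2) set) (U :: (real^2) set) (a :: real). V \<Subset> U \<and> U \<Subset> \<Omega> \<longrightarrow>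
          Lp_norm p V (\<lambda>x. norm (weak_gradient \<Omega> u x))
            \<le> ennreal (C * (1 / setdist V (frontier U))) * Lp_norm p U (\<lambda>x. u x - a)))"
proof -
  define c where "c = gradient_const DIM(real^2) p * unit_ball_vol (real DIM(real^2))"
  have c: "0 < c" unfolding c_def using gradient_const_pos[of "DIM(real^2)" p] by (intro mult_pos_pos) auto
  have p: "0 < p" using assms by simp
  show ?thesis
  \<comment> \<open>The factor 2 comes from the choice of the radius as half the distance to the frontier.\<close>
  proof (intro exI[of _ "2 * c powr (1 / p)"] conjI allI impI)
    show "0 < 2 * c powr (1 / p)" using c by simp
    fix \<Omega> :: "(real^2) set" and u :: "real^2 \<Rightarrow> real" and V U :: "(real^2) set" and a :: real
    assume \<Omega>: "domain \<Omega> \<and> infinity_harmonic \<Omega> u" and VU: "V \<Subset> U \<and> U \<Subset> \<Omega>"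
    define d where "d = setdist V (frontier U)"
    have U: "open U" "U \<subseteq> \<Omega>" "bounded U" and V: "V \<subseteq> U" "bounded V" "closure V \<subseteq> U"
      using VU closure_subset[of U] closure_subset[of V]
      by (auto simp: compactly_contained_def domain_def)
    show "Lp_norm p V (\<lambda>x. norm (weak_gradient \<Omega> u x))
        \<le> ennreal (2 * c powr (1 / p) * (1 / setdist V (frontier U))) * Lp_norm p U (\<lambda>x. u x - a)"
    \<comment> \<open>The distance from the empty set is 0 by convention, so this case is separate.\<close>
    proof (cases "V = {}")
      case True
      then show ?thesis by (simp add: Lp_norm_def)
    next
      case False
      then have d: "0 < d" unfolding d_def using setdist_frontier_pos U V by blast
      have "(\<integral>\<^sup>+x\<in>V. ennreal (norm (weak_gradient \<Omega> u x) powr p) \<partial>lebesgue)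
          \<le> ennreal (c / (d / 2) powr p) * (\<integral>\<^sup>+x\<in>U. ennreal (\<bar>u x - a\<bar> powr p) \<partial>lebesgue)"
        unfolding c_def
      proof (rule integral_gradient_bound[OF _ _ p U(1,2)])
        show "cball x (d / 2) \<subseteq> U" if "x \<in> V" for x
          by (rule cball_subset_of_setdist_frontier[OF that V(1)]) (use d in \<open>auto simp: d_def\<close>)
      qed (use \<Omega> d in \<open>auto simp: domain_def\<close>)
      moreover have "c / (d / 2) powr p = (2 * c powr (1 / p) * (1 / d)) powr p"
        using c d p by (simp add: powr_mult powr_divide powr_powr)
      ultimately show ?thesis
        unfolding d_def[symmetric] using c d by (intro Lp_norm_le[OF p]) auto
    qed
  qed
qed

end
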